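(* Let $\Lambda\in\mathcal F_0$ and $\nu\in M(\mathbb T)$, and let $\mu\in M(\mathbb R)$ be the measure defined by $$\hat\mu(\xi)=W_{\hat\nu,\Lambda}(\xi)=\sum_{n\in\mathbb Z}\hat\nu(n)\Lambda(\xi-n).$$ (a) If $\nu$ is an absolutely continuous measure on $\mathbb T$, then $\mu$ is an absolutely continuous measure on $\mathbb R$ (both with respect to Lebesgue measure). (b) If $\nu$ is a discrete measure, then either $\mu\equiv 0$ or $\mu$ is a discrete measure.
   Context: $M(\mathbb R)$ and $M(\mathbb T)$ are the spaces of bounded regular (complex) Borel measures on $\mathbb R$ and on $\mathbb T$; $\mathbb T$ is identified with $[0,1)$. Fourier transforms are $\hat f(\xi)=\int_{\mathbb R}f(x)e^{-2\pi i\xi x}\,dx$, $\hat\mu(\xi)=\int_{\mathbb R}e^{-2\pi i\xi x}\,d\mu(x)$ for $\mu\in M(\mathbb R)$, and $\hat\nu(n)=\int_{\mathbb T}e^{-2\pi i n x}\,d\nu(x)$ for $\nu\in M(\mathbb T)$. A measure is discrete if it is a countable sum of point masses. $M_1(\mathbb R)$ denotes the Fourier multipliers of $L^1(\mathbb R)$ and $M_1(\mathbb Z)$ those of $L^1(\mathbb T)$, with operator norms; they are identified with $M(\mathbb R)$ and $M(\mathbb T)$ respectively (via $\mu\mapsto\hat\mu$, $\nu\mapsto\hat\nu$). $S_1^0(\mathbb R)$ is the set of $\Lambda\in L^\infty(\mathbb R)$ such that for each finitely supported $\phi\in M_1(\mathbb Z)$ the function $W_{\phi,\Lambda}(\xi)=\sum_{n\in\mathbb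 Z}\phi(n)\Lambda(\xi-n)$ belongs to $M_1(\mathbb R)$, and there is a constant $C_{1,\Lambda}$ (independent of $\phi$) with $\|W_{\phi,\Lambda}\|_{M_1(\mathbb R)}\le C_{1,\Lambda}\|\phi\|_{M_1(\mathbb Z)}$. $\mathcal F_0=\{\Lambda\in S_1^0(\mathbb R):\delta_\Lambda<\infty\}$, where $\delta_\Lambda=\operatorname{ess\,sup}_\xi\sum_{n\in\mathbb Z}|\Lambda(\xi+n)|$. For $\Lambda\in\mathcal F_0$ and $\nu\in M(\mathbb T)$ the series defining $W_{\hat\nu,\Lambda}$ converges a.e. and is (a.e. equal to) the Fourier transform of a measure in $M(\mathbb R)$. *)

theory Defs
  imports "HOL-Probability.Essential_Supremum"
begin

text \<open>
  Complex measures are countably additive set functions on the \<sigma>-algebra of \<open>M\<close> (only the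
  \<sigma>-algebra of \<open>M\<close> matters; values off \<open>sets M\<close> are irrelevant).  Boundedness is automatic, and on
  the Borel sets of the real line or the circle so is regularity.
\<close>

definition complex_measure :: "'a measure \<Rightarrow> ('a set \<Rightarrow> complex) \<Rightarrow> bool" where
  "complex_measure M \<mu> \<longleftrightarrow>
     (\<forall>A :: nat \<Rightarrow> 'a set. range A \<subseteq> sets M \<longrightarrow> disjoint_family A \<longrightarrow>
        (\<lambda>i. \<mu> (A i)) sums \<mu> (\<Union>i. A i))"

text \<open>
  The positive variation \<open>A \<mapsto> sup {\<rho> B | B \<subseteq> A}\<close> of a real signed measure; \<open>ennreal\<close> truncates
  negative values to \<open>0\<close>, which is harmless because \<open>B = {}\<close> already contributes \<open>0\<close>.
\<close>

definition pos_variation :: "'a measure \<Rightarrow> ('a set \<Rightarrow> real) \<Rightarrow> 'a measure" where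
  "pos_variation M \<rho> =
     measure_of (space M) (sets M) (\<lambda>A. SUP B\<in>{B \<in> sets M. B \<subseteq> A}. ennreal (\<rho> B))"

text \<open>Integration against a complex measure, by Jordan decomposition of real and imaginary part.\<close>

definition cm_integral :: "'a measure \<Rightarrow> ('a set \<Rightarrow> complex) \<Rightarrow> ('a \<Rightarrow> complex) \<Rightarrow> complex" where
  "cm_integral M \<mu> f =
     (integral\<^sup>L (pos_variation M (\<lambda>A. Re (\<mu> A))) f
        - integral\<^sup>L (pos_variation M (\<lambda>A. - Re (\<mu> A))) f)
     + \<i> * (integral\<^sup>L (pos_variation M (\<lambda>A. Im (\<mu> A))) f
        - integral\<^sup>L (pos_variation M (\<lambda>A. - Im (\<mu> A))) f)"

text \<open>
  The circle is identified with \<open>[0,1)\<close>; under this identification its Borel sets are exactly the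
  Borel subsets of \<open>[0,1)\<close>.
\<close>

abbreviation borel_circle :: "real measure" where
  "borel_circle \<equiv> restrict_space borel {0..<1}"

abbreviation lebesgue_circle :: "real measure" where
  "lebesgue_circle \<equiv> lebesgue_on {0..<1}"

definition M_R :: "(real set \<Rightarrow> complex) set" where
  "M_R = {\<mu>. complex_measure borel \<mu>}"

definition M_T :: "(real set \<Rightarrow> complex) set" where
  "M_T = {\<nu>. complex_measure borel_circle \<nu>}"

definition ac_measure :: "real measure \<Rightarrow> (real set \<Rightarrow> complex) \<Rightarrow> bool" where
  "ac_measure M \<mu> \<longleftrightarrow> (\<forall>A \<in> sets M. emeasure lebesgue A = 0 \<longrightarrow> \<mu> A = 0)"

text \<open>
  A countable sum of point masses \<open>c x\<close> at the points \<open>x \<in> S\<close>.  The case \<open>A = space M\<close> forces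
  \<open>c\<close> to be absolutely summable on \<open>S\<close>.
\<close>

definition discrete_measure :: "'a measure \<Rightarrow> ('a set \<Rightarrow> complex) \<Rightarrow> bool" where
  "discrete_measure M \<mu> \<longleftrightarrow>
     (\<exists>S c. countable S \<and> S \<subseteq> space M \<and> (\<forall>A \<in> sets M. (c has_sum \<mu> A) (A \<inter> S)))"

definition fourier_R :: "(real \<Rightarrow> complex) \<Rightarrow> real \<Rightarrow> complex" where
  "fourier_R f \<xi> = (LINT x|lebesgue. f x * cis (- 2 * pi * \<xi> * x))"

definition fourier_T :: "(real \<Rightarrow> complex) \<Rightarrow> int \<Rightarrow> complex" where
  "fourier_T f n = (LINT x|lebesgue_circle. f x * cis (- 2 * pi * of_int n * x))"

definition fourier_M_R :: "(real set \<Rightarrow> complex) \<Rightarrow> real \<Rightarrow> complex" where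
  "fourier_M_R \<mu> \<xi> = cm_integral borel \<mu> (\<lambda>x. cis (- 2 * pi * \<xi> * x))"

definition fourier_M_T :: "(real set \<Rightarrow> complex) \<Rightarrow> int \<Rightarrow> complex" where
  "fourier_M_T \<nu> n = cm_integral borel_circle \<nu> (\<lambda>x. cis (- 2 * pi * of_int n * x))"

definition L_infty_R :: "(real \<Rightarrow> complex) set" where
  "L_infty_R = {m \<in> borel_measurable lebesgue. \<exists>B. AE \<xi> in lebesgue. cmod (m \<xi>) \<le> B}"

text \<open>
  Fourier multipliers of \<open>L\<^sup>1\<close>.  \<open>C\<close> is a bound for the multiplier \<open>m\<close> if the operator
  \<open>f \<mapsto> g\<close>, where \<open>g\<close> has Fourier transform \<open>m\<close> times that of \<open>f\<close>, is defined on all of \<open>L\<^sup>1\<close>,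
  maps into \<open>L\<^sup>1\<close> and is bounded by \<open>C\<close>; the operator norm is the least such \<open>C\<close>.
\<close>

definition multiplier_bound_R :: "(real \<Rightarrow> complex) \<Rightarrow> real \<Rightarrow> bool" where
  "multiplier_bound_R m C \<longleftrightarrow> 0 \<le> C \<and>
     (\<forall>f. integrable lebesgue f \<longrightarrow>
        (\<exists>g. integrable lebesgue g \<and>
             (AE \<xi> in lebesgue. fourier_R g \<xi> = m \<xi> * fourier_R f \<xi>) \<and>
             (LINT x|lebesgue. cmod (g x)) \<le> C * (LINT x|lebesgue. cmod (f x))))"

definition M1_R :: "(real \<Rightarrow> complex) set" where
  "M1_R = {m \<in> L_infty_R. \<exists>C. multiplier_bound_R m C}"

definition norm_M1_R :: "(real \<Rightarrow> complex) \<Rightarrow> real" where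
  "norm_M1_R m = Inf {C. multiplier_bound_R m C}"

definition multiplier_bound_Z :: "(int \<Rightarrow> complex) \<Rightarrow> real \<Rightarrow> bool" where
  "multiplier_bound_Z \<phi> C \<longleftrightarrow> 0 \<le> C \<and>
     (\<forall>f. integrable lebesgue_circle f \<longrightarrow>
        (\<exists>g. integrable lebesgue_circle g \<and>
             (\<forall>n. fourier_T g n = \<phi> n * fourier_T f n) \<and>
             (LINT x|lebesgue_circle. cmod (g x)) \<le> C * (LINT x|lebesgue_circle. cmod (f x))))"

definition M1_Z :: "(int \<Rightarrow> complex) set" where
  "M1_Z = {\<phi>. bounded (range \<phi>) \<and> (\<exists>C. multiplier_bound_Z \<phi> C)}"

definition norm_M1_Z :: "(int \<Rightarrow> complex) \<Rightarrow> real" where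
  "norm_M1_Z \<phi> = Inf {C. multiplier_bound_Z \<phi> C}"

definition W :: "(int \<Rightarrow> complex) \<Rightarrow> (real \<Rightarrow> complex) \<Rightarrow> real \<Rightarrow> complex" where
  "W \<phi> \<Lambda> \<xi> = (\<Sum>\<^sub>\<infinity>n. \<phi> n * \<Lambda> (\<xi> - of_int n))"

definition S10_R :: "(real \<Rightarrow> complex) set" where
  "S10_R = {\<Lambda> \<in> L_infty_R.
     \<exists>C. \<forall>\<phi> \<in> M1_Z. finite {n. \<phi> n \<noteq> 0} \<longrightarrow>
       W \<phi> \<Lambda> \<in> M1_R \<and> norm_M1_R (W \<phi> \<Lambda>) \<le> C * norm_M1_Z \<phi>}"

definition delta :: "(real \<Rightarrow> complex) \<Rightarrow> ennreal" where
  "delta \<Lambda> = esssup lebesgue (\<lambda>\<xi>. \<Sum>\<^sub>\<infinity>n::int. ennreal (cmod (\<Lambda> (\<xi> + of_int n))))"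

definition F0 :: "(real \<Rightarrow> complex) set" where
  "F0 = {\<Lambda> \<in> S10_R. delta \<Lambda> < \<infinity>}"

end

theory Submission imports Defs "HOL-Probability.Levy" begin

text \<open>
  By periodization, \<open>\<delta>\<^sub>\<Lambda> < \<infinity>\<close> gives \<open>\<Lambda> \<in> L\<^sup>1\<close>. Let
  \<open>h(x) = \<integral> \<Lambda>(\<eta>) e(\<eta> x) d\<eta>\<close> be the inverse Fourier transform of \<open>\<Lambda>\<close>. Then \<open>\<mu>\<close> is \<open>h\<close> times the
  1-periodic extension of \<open>\<nu>\<close>, so absolute continuity and discreteness pass from \<open>\<nu>\<close> to \<open>\<mu>\<close>.

  To compare the two sides, multiply both by the Gaussian \<open>G(x) = exp (- \<pi> x\<^sup>2)\<close>: this makes the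
  second one a finite measure, and it turns the hypothesis, which holds only for almost every
  frequency, into an identity at every frequency, because it is convolved with \<open>G\<close>. The two Fourier
  transforms then agree by Fubini and Poisson summation for \<open>G\<close>, and the measures agree by
  Levy's uniqueness theorem.
\<close>

section \<open>Jordan decomposition and densities of complex measures\<close>

text \<open>A set function admits neither Fubini nor dominated convergence, so both complex measures
  are first rewritten as integrable densities \<open>u\<close>, \<open>v\<close> over finite
  positive measures \<open>N\<close>, \<open>M\<close>. Both claims then become one statement about
  supports: if, for every integer k, \<open>u\<close> vanishes a.e. on the part of A - k inside
  [0,1), then \<open>v\<close> vanishes a.e. on A. For (a), A is a Lebesgue null set, whose
  translates are null again; for (b), A is the complement of S + Z, where S carries the atoms of
  \<nu>. The function h enters only as a bounded measurable factor, and the weight \<open>G\<close>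
  can be removed at the end because it is nowhere zero. The obstacle behind the weight is that the
  periodic extension of \<nu> usually has infinite mass, hence no Fourier transform as a finite
  measure. The constant \<pi> in \<open>G\<close> makes it its own transform for the kernel exp(-2
  \<pi> i x \<xi>), so the same function is the weight in space and the averaging kernel in
  frequency.\<close>

definition signed_measure :: "'a measure \<Rightarrow> ('a set \<Rightarrow> real) \<Rightarrow> bool" where
  "signed_measure M \<rho> \<longleftrightarrow>
     (\<forall>A :: nat \<Rightarrow> 'a set. range A \<subseteq> sets M \<longrightarrow> disjoint_family A \<longrightarrow>
        (\<lambda>i. \<rho> (A i)) sums \<rho> (\<Union>i. A i))"

lemma signed_measureD:
  "signed_measure M \<rho> \<Longrightarrow> range A \<subseteq> sets M \<Longrightarrow> disjoint_family A \<Longrightarrow>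
    (\<lambda>i. \<rho> (A i)) sums \<rho> (\<Union>i::nat. A i)"
  by (simp add: signed_measure_def)

lemma signed_measure_uminus: "signed_measure M \<rho> \<Longrightarrow> signed_measure M (\<lambda>A. - \<rho> A)"
  by (auto simp: signed_measure_def intro: sums_minus)

lemma complex_measure_signed:
  assumes "complex_measure M \<mu>"
  shows "signed_measure M (\<lambda>A. Re (\<mu> A))" "signed_measure M (\<lambda>A. Im (\<mu> A))"
  using assms by (auto simp: signed_measure_def complex_measure_def intro: sums_Re sums_Im)

lemma signed_measure_empty:
  assumes "signed_measure M \<rho>" shows "\<rho> {} = 0"
proof -
  have "(\<lambda>i::nat. \<rho> {}) sums \<rho> (\<Union>i::nat. {})"
    by (rule signed_measureD[OF assms]) (auto simp: disjoint_family_on_def)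
  then show ?thesis
    using sums_summable summable_const_iff by blast
qed

lemma signed_measure_Un:
  assumes \<rho>: "signed_measure M \<rho>" and A: "A \<in> sets M" and B: "B \<in> sets M" and "A \<inter> B = {}"
  shows "\<rho> (A \<union> B) = \<rho> A + \<rho> B"
proof -
  have "(\<lambda>i. \<rho> (binaryset A B i)) sums \<rho> (\<Union>i. binaryset A B i)"
    using assms by (intro signed_measureD[OF \<rho>]) 
      (auto simp: range_binaryset_eq disjoint_family_on_def binaryset_def)
  moreover have "(\<lambda>i. \<rho> (binaryset A B i)) sums (\<rho> A + \<rho> B)"
    by (rule binaryset_sums) (rule signed_measure_empty[OF \<rho>])
  ultimately show ?thesis
    by (simp add: UN_binaryset_eq sums_unique2)
qed

lemma signed_measure_Diff:
  assumes \<rho>: "signed_measure M \<rho>" and "A \<in> sets M" "B \<in> sets M" "B \<subseteq> A"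
  shows "\<rho> (A - B) = \<rho> A - \<rho> B"
  using signed_measure_Un[OF \<rho>, of B "A - B"] assms(2-4)
  by (simp add: Un_absorb1)

text \<open>Truncation at 0 makes \<open>ennreal\<close> only subadditive on reals of mixed sign;
  this is the direction that upper bounds on the positive variation require.\<close>

lemma ennreal_add_le: "ennreal (a + b) \<le> ennreal a + ennreal b"
  by (cases "0 \<le> a"; cases "0 \<le> b")
    (auto simp: ennreal_neg ennreal_leI simp flip: ennreal_plus)

lemma ennreal_sum_le: "ennreal (sum f I) \<le> (\<Sum>i\<in>I. ennreal (f i))"
proof (induction I rule: infinite_finite_induct)
  case (insert x F)
  then show ?case
    using ennreal_add_le[of "f x" "sum f F"] by (simp add: add_left_mono order_trans)
qed auto

text \<open>\<open>measure_of\<close> returns the zero measure unless its set function is countably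
  additive, so the defining formula has to be earned. Gluing competitors on disjoint sets gives
  superadditivity; cutting one competitor along the partition gives the converse bound.\<close>

lemma emeasure_pos_variation:
  assumes \<rho>: "signed_measure M \<rho>" and "X \<in> sets M"
  shows "emeasure (pos_variation M \<rho>) X = (SUP B\<in>{B \<in> sets M. B \<subseteq> X}. ennreal (\<rho> B))"
proof -
  define p where "p A = (SUP B\<in>{B \<in> sets M. B \<subseteq> A}. ennreal (\<rho> B))" for A
  have p_upper: "ennreal (\<rho> B) \<le> p A" if "B \<in> sets M" "B \<subseteq> A" for A B
    unfolding p_def using that by (intro SUP_upper) auto
  have p_mono: "p A \<le> p B" if "A \<subseteq> B" for A B
    unfolding p_def using that by (intro SUP_subset_mono) auto
  have p_empty: "p {} = 0"
  proof -
    have "{B \<in> sets M. B \<subseteq> {}} = {{}}" by auto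
    then show ?thesis by (simp add: p_def signed_measure_empty[OF \<rho>])
  qed
  have super: "p A + p B \<le> p (A \<union> B)" if AB: "A \<inter> B = {}" for A B
  proof -
    have *: "ennreal (\<rho> C) + ennreal (\<rho> D) \<le> p (A \<union> B)"
      if C: "C \<in> sets M" "C \<subseteq> A" and D: "D \<in> sets M" "D \<subseteq> B" for C D
    proof -
      \<comment> \<open>A set of negative value is truncated to 0, so the other set alone is a
        competitor; otherwise the union is.\<close>
      consider "\<rho> C < 0" | "\<rho> D < 0" | "0 \<le> \<rho> C" "0 \<le> \<rho> D" by linarith
      then show ?thesis
      proof cases
        case 1 then show ?thesis using p_upper[of D "A \<union> B"] D by (auto simp: ennreal_neg)
      next
        case 2 then show ?thesis using p_upper[of C "A \<union> B"] C by (auto simp: ennreal_neg)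
      next
        case 3
        have "\<rho> (C \<union> D) = \<rho> C + \<rho> D"
          using AB C D by (intro signed_measure_Un[OF \<rho>]) auto
        then show ?thesis using p_upper[of "C \<union> D" "A \<union> B"] 3 C D by auto
      qed
    qed
    have ne: "{B \<in> sets M. B \<subseteq> X} \<noteq> {}" for X by auto
    have "p A + p B = (SUP C\<in>{C \<in> sets M. C \<subseteq> A}. ennreal (\<rho> C) + p B)"
      unfolding p_def by (rule ennreal_SUP_add_left[symmetric]) (fact ne)
    also have "\<dots> \<le> p (A \<union> B)"
    proof (intro SUP_least)
      fix C assume C: "C \<in> {C \<in> sets M. C \<subseteq> A}"
      have "ennreal (\<rho> C) + p B = (SUP D\<in>{D \<in> sets M. D \<subseteq> B}. ennreal (\<rho> C) + ennreal (\<rho> D))"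
        unfolding p_def add.commute[of "ennreal (\<rho> C)"]
        by (rule ennreal_SUP_add_left[symmetric]) (fact ne)
      also have "\<dots> \<le> p (A \<union> B)"
        using C by (intro SUP_least *) auto
      finally show "ennreal (\<rho> C) + p B \<le> p (A \<union> B)" .
    qed
    finally show ?thesis .
  qed
  have "countably_additive (sets M) p"
  proof (rule countably_additiveI)
    fix A :: "nat \<Rightarrow> 'a set"
    assume A: "range A \<subseteq> sets M" "disjoint_family A"
    have "(\<Sum>i. p (A i)) \<le> p (\<Union>i. A i)"
    proof -
      have "(\<Sum>i<n. p (A i)) \<le> p (\<Union>i<n. A i)" for n
      proof (induction n)
        case (Suc n)
        have "(\<Union>i<n. A i) \<inter> A n = {}"
          using A(2) by (auto simp: disjoint_family_on_def) (metis IntI empty_iff nat_neq_iff)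
        then have "(\<Sum>i<n. p (A i)) + p (A n) \<le> p ((\<Union>i<n. A i) \<union> A n)"
          using Suc super by (meson add_right_mono order_trans)
        moreover have "(\<Union>i<n. A i) \<union> A n = (\<Union>i<Suc n. A i)"
          by (auto simp: less_Suc_eq)
        ultimately show ?case by simp
      qed (simp add: p_empty)
      also have "p (\<Union>i<n. A i) \<le> p (\<Union>i. A i)" for n
        by (rule p_mono) auto
      finally show ?thesis
        unfolding suminf_eq_SUP by (intro SUP_least)
    qed
    moreover have "p (\<Union>i. A i) \<le> (\<Sum>i. p (A i))"
      unfolding p_def[of "\<Union>i. A i"]
    proof (intro SUP_least)
      fix B assume B: "B \<in> {B \<in> sets M. B \<subseteq> (\<Union>i. A i)}"
      have "(\<lambda>i. \<rho> (B \<inter> A i)) sums \<rho> (\<Union>i. B \<inter> A i)"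
        using A B by (intro signed_measureD[OF \<rho>]) (auto simp: disjoint_family_on_def)
      also have "(\<Union>i. B \<inter> A i) = B" using B by auto
      finally have "(\<lambda>n. ennreal (\<Sum>i<n. \<rho> (B \<inter> A i))) \<longlonglongrightarrow> ennreal (\<rho> B)"
        unfolding sums_def by (rule tendsto_ennrealI)
      then show "ennreal (\<rho> B) \<le> (\<Sum>i. p (A i))"
      proof (rule LIMSEQ_le_const2, intro exI allI impI)
        fix n
        have "ennreal (\<Sum>i<n. \<rho> (B \<inter> A i)) \<le> (\<Sum>i<n. ennreal (\<rho> (B \<inter> A i)))"
          by (rule ennreal_sum_le)
        also have "\<dots> \<le> (\<Sum>i<n. p (A i))"
          using A B by (intro sum_mono p_upper) auto
        also have "\<dots> \<le> (\<Sum>i. p (A i))"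
          by (rule sum_le_suminf) auto
        finally show "ennreal (\<Sum>i<n. \<rho> (B \<inter> A i)) \<le> (\<Sum>i. p (A i))" .
      qed
    qed
    ultimately show "(\<Sum>i. p (A i)) = p (\<Union>i. A i)" by (rule antisym)
  qed
  then have "emeasure (pos_variation M \<rho>) X = p X"
    unfolding pos_variation_def p_def[symmetric] using \<open>X \<in> sets M\<close>
    by (intro emeasure_measure_of_sigma) (auto simp: positive_def p_empty sets.sigma_algebra_axioms)
  then show ?thesis by (simp add: p_def)
qed

lemma sets_pos_variation [simp, measurable_cong]: "sets (pos_variation M \<rho>) = sets M"
  by (simp add: pos_variation_def)

lemma space_pos_variation [simp]: "space (pos_variation M \<rho>) = space M"
  by (simp add: pos_variation_def)

lemma pos_variation_upper:
  assumes "signed_measure M \<rho>" "A \<in> sets M" "B \<in> sets M" "B \<subseteq> A"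
  shows "ennreal (\<rho> B) \<le> emeasure (pos_variation M \<rho>) A"
  unfolding emeasure_pos_variation[OF assms(1,2)] using assms by (intro SUP_upper) auto

text \<open>
  If the positive variation were infinite, repeated bisection would give a decreasing sequence of
  sets on which \<open>\<rho>\<close> is unbounded, although \<open>\<rho>\<close> converges along it.
\<close>

lemma finite_measure_pos_variation:
  assumes \<rho>: "signed_measure M \<rho>"
  shows "finite_measure (pos_variation M \<rho>)"
proof
  let ?P = "pos_variation M \<rho>"
  show "emeasure ?P (space ?P) \<noteq> \<infinity>"
  proof
    assume top: "emeasure ?P (space ?P) = \<infinity>"
    have step: "\<exists>B\<in>sets M. B \<subseteq> A \<and> emeasure ?P B = \<infinity> \<and> K \<le> \<bar>\<rho> B\<bar>"
      if A: "A \<in> sets M" "emeasure ?P A = \<infinity>" for A K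
    proof -
      \<comment> \<open>This threshold makes both halves large: \<open>\<rho> B\<close> exceeds K,
        and \<open>\<rho> (A - B)\<close> is \<open>\<rho> A - \<rho> B\<close>, which lies below
        \<open>- \<bar>K\<bar>\<close>. Whichever half keeps infinite variation can therefore be
        chosen.\<close>
      have "ennreal (\<bar>\<rho> A\<bar> + \<bar>K\<bar>) < (SUP B\<in>{B \<in> sets M. B \<subseteq> A}. ennreal (\<rho> B))"
        using A by (simp add: emeasure_pos_variation[OF \<rho>, symmetric])
      then obtain B where B: "B \<in> sets M" "B \<subseteq> A" "ennreal (\<bar>\<rho> A\<bar> + \<bar>K\<bar>) < ennreal (\<rho> B)"
        unfolding less_SUP_iff by auto
      then have big: "\<bar>\<rho> A\<bar> + \<bar>K\<bar> < \<rho> B" by (subst (asm) ennreal_less_iff) auto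
      show ?thesis
      proof (cases "emeasure ?P B = \<infinity>")
        case True
        with B big show ?thesis by (intro bexI[of _ B]) auto
      next
        case False
        have "emeasure ?P (A - B) = \<infinity>"
          using A B False by (subst emeasure_Diff) auto
        moreover have "\<rho> (A - B) = \<rho> A - \<rho> B"
          using A B by (intro signed_measure_Diff[OF \<rho>]) auto
        ultimately show ?thesis
          using A B big by (intro bexI[of _ "A - B"]) auto
      qed
    qed
    have "\<exists>A. \<forall>n. (A n \<in> sets M \<and> emeasure ?P (A n) = \<infinity>) \<and>
        (A (Suc n) \<subseteq> A n \<and> real n \<le> \<bar>\<rho> (A (Suc n))\<bar>)"
    proof (rule dependent_nat_choice)
      show "\<exists>x. x \<in> sets M \<and> emeasure ?P x = \<infinity>"
        using top by (intro exI[of _ "space M"]) auto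
    qed (use step in blast)
    then obtain A where A: "\<And>n. A n \<in> sets M" "\<And>n. A (Suc n) \<subseteq> A n"
      "\<And>n. real n \<le> \<bar>\<rho> (A (Suc n))\<bar>" by blast
    have decr: "A j \<subseteq> A i" if "i \<le> j" for i j
      using A(2) that by (rule lift_Suc_antimono_le)
    have "disjoint_family (\<lambda>i. A i - A (Suc i))"
      unfolding disjoint_family_on_def
    proof (intro ballI impI)
      fix i j :: nat assume "i \<noteq> j"
      then consider "Suc i \<le> j" | "Suc j \<le> i" by linarith
      then show "(A i - A (Suc i)) \<inter> (A j - A (Suc j)) = {}"
        using decr by cases blast+
    qed
    then have "(\<lambda>i. \<rho> (A i - A (Suc i))) sums \<rho> (\<Union>i. A i - A (Suc i))"
      using A(1) by (intro signed_measureD[OF \<rho>]) auto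
    moreover have "(\<Sum>i<n. \<rho> (A i - A (Suc i))) = \<rho> (A 0) - \<rho> (A n)" for n
      using signed_measure_Diff[OF \<rho> A(1) A(1) A(2)] by (induction n) auto
    ultimately have "(\<lambda>n. \<rho> (A 0) - \<rho> (A n)) \<longlonglongrightarrow> \<rho> (\<Union>i. A i - A (Suc i))"
      by (simp add: sums_def)
    from tendsto_diff[OF tendsto_const[of "\<rho> (A 0)"] this]
    have "Bseq (\<lambda>n. \<rho> (A n))"
      by (intro convergent_imp_Bseq convergentI) simp
    then obtain K where "\<And>n. \<bar>\<rho> (A n)\<bar> \<le> K"
      by (auto simp: Bseq_def)
    moreover obtain n where "K < real n" using reals_Archimedean2 by blast
    ultimately show False using A(3)[of n] by (meson not_less order_trans)
  qed
qed

text \<open>Since \<open>\<rho> B = \<rho> A - \<rho> (A - B)\<close>, every competitor for the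
  positive variation on A is at most \<open>\<rho> A\<close> plus the negative variation of A. The
  same bound for \<open>- \<rho>\<close> is the reverse inequality, so no Hahn set has to be
  constructed.\<close>

lemma Jordan_decomposition:
  assumes \<rho>: "signed_measure M \<rho>" and A: "A \<in> sets M"
  shows "\<rho> A = measure (pos_variation M \<rho>) A - measure (pos_variation M (\<lambda>A. - \<rho> A)) A"
proof -
  have le: "measure (pos_variation M \<rho>) A \<le> \<rho> A + measure (pos_variation M (\<lambda>A. - \<rho> A)) A"
    if \<rho>: "signed_measure M \<rho>" for \<rho>
  proof -
    interpret Q: finite_measure "pos_variation M (\<lambda>A. - \<rho> A)"
      by (intro finite_measure_pos_variation signed_measure_uminus \<rho>)
    let ?r = "\<rho> A + measure (pos_variation M (\<lambda>A. - \<rho> A)) A"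
    have B: "\<rho> B \<le> ?r" if B: "B \<in> sets M" "B \<subseteq> A" for B
    proof -
      have "ennreal (- \<rho> (A - B)) \<le> ennreal (measure (pos_variation M (\<lambda>A. - \<rho> A)) A)"
        unfolding Q.emeasure_eq_measure[symmetric] using A B
        by (intro pos_variation_upper signed_measure_uminus \<rho>) auto
      then show ?thesis
        using signed_measure_Diff[OF \<rho> A B] by (simp add: ennreal_le_iff)
    qed
    have "0 \<le> ?r" using B[of "{}"] signed_measure_empty[OF \<rho>] by simp
    moreover have "emeasure (pos_variation M \<rho>) A \<le> ennreal ?r"
      unfolding emeasure_pos_variation[OF \<rho> A] using B by (intro SUP_least ennreal_leI) auto
    ultimately show ?thesis
      unfolding measure_def by (rule enn2real_leI)
  qed
  show ?thesis
    using le[OF \<rho>] le[OF signed_measure_uminus[OF \<rho>]] by simp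
qed

text \<open>The dominating measure is a lattice supremum, formed one measure at a time; its mass is
  at most the sum of the masses and so remains finite.\<close>

lemma finite_measures_dominated:
  fixes D :: "'i \<Rightarrow> 'a measure"
  assumes "finite J" "\<And>j. j \<in> J \<Longrightarrow> finite_measure (D j)" "\<And>j. j \<in> J \<Longrightarrow> sets (D j) = sets M"
  shows "\<exists>S. finite_measure S \<and> sets S = sets M \<and>
    (\<forall>j\<in>J. \<forall>A\<in>sets M. emeasure (D j) A \<le> emeasure S A)"
  using assms
proof (induction J rule: finite_induct)
  case empty
  have "finite_measure (null_measure M)" by standard simp
  then show ?case by (intro exI[of _ "null_measure M"]) simp
next
  case (insert j J)
  then obtain S where S: "finite_measure S" "sets S = sets M"
    "\<And>j A. j \<in> J \<Longrightarrow> A \<in> sets M \<Longrightarrow> emeasure (D j) A \<le> emeasure S A" by auto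
  have j: "finite_measure (D j)" "sets (D j) = sets S" using insert.prems S(2) by auto
  interpret S: finite_measure S by fact
  interpret Dj: finite_measure "D j" by fact
  let ?S = "sup_measure' S (D j)"
  have "emeasure ?S (space S) \<le> emeasure S (space S) + emeasure (D j) (space (D j))"
    using j by (subst emeasure_sup_measure')
      (auto intro!: SUP_least add_mono emeasure_mono dest: sets.sets_into_space simp: sets_eq_imp_space_eq[OF j(2)])
  also have "\<dots> < \<infinity>" by (simp add: S.emeasure_finite Dj.emeasure_finite less_top[symmetric])
  finally have "finite_measure ?S" using j by (intro finite_measureI) simp
  moreover have "emeasure (D i) A \<le> emeasure ?S A" if "i \<in> insert j J" "A \<in> sets M" for i A
    using that S j le_emeasure_sup_measure'1[of "D j" S A] le_emeasure_sup_measure'2[of "D j" S A]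
    by (auto intro: order_trans)
  ultimately show ?case using S(2) j by (intro exI[of _ ?S]) auto
qed

text \<open>Radon-Nikodym over one common base, so that linear combinations of integrals against
  different measures merge into a single integral.\<close>

lemma finite_measures_common_density:
  fixes D :: "'i \<Rightarrow> 'a measure"
  assumes "finite J" "\<And>j. j \<in> J \<Longrightarrow> finite_measure (D j)" "\<And>j. j \<in> J \<Longrightarrow> sets (D j) = sets M"
  obtains S and d :: "'i \<Rightarrow> 'a \<Rightarrow> real" where "finite_measure S" "sets S = sets M"
    "\<And>j. j \<in> J \<Longrightarrow> integrable S (d j)" "\<And>j x. j \<in> J \<Longrightarrow> 0 \<le> d j x"
    "\<And>j. j \<in> J \<Longrightarrow> D j = density S (d j)"
proof -
  obtain S where S: "finite_measure S" "sets S = sets M"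
    "\<And>j A. j \<in> J \<Longrightarrow> A \<in> sets M \<Longrightarrow> emeasure (D j) A \<le> emeasure S A"
    using finite_measures_dominated[of J D M] assms by blast
  interpret S: finite_measure S by fact
  have "\<exists>d. integrable S d \<and> (\<forall>x. 0 \<le> d x) \<and> D j = density S (\<lambda>x. ennreal (d x))"
    if j: "j \<in> J" for j
  proof -
    have sets: "sets (D j) = sets S" using assms j S by simp
    interpret Dj: finite_measure "D j" using assms j by simp
    have ac: "absolutely_continuous S (D j)"
      using S(3)[OF j] sets S(2) by (force simp: absolutely_continuous_def null_sets_def)
    obtain d where d: "d \<in> borel_measurable S" "AE x in S. RN_deriv S (D j) x = ennreal (d x)"
      "\<And>x. 0 \<le> d x"
      using S.real_RN_deriv[OF Dj.finite_measure_axioms ac sets] by metis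
    have "D j = density S (RN_deriv S (D j))"
      using S.density_RN_deriv[OF ac sets] by simp
    also have "\<dots> = density S (\<lambda>x. ennreal (d x))"
      using d by (intro density_cong) auto
    finally have D: "D j = density S (\<lambda>x. ennreal (d x))" .
    have "(\<integral>\<^sup>+x. ennreal (d x) \<partial>S) = emeasure (D j) (space S)"
      unfolding D using d(1) by (subst emeasure_density)
        (auto intro!: nn_integral_cong simp: indicator_def)
    also have "\<dots> < \<infinity>" using Dj.emeasure_finite by (simp add: less_top[symmetric])
    finally have "integrable S d"
      using d by (intro integrableI_nonneg) auto
    then show ?thesis using D d by blast
  qed
  then show ?thesis using S that by metis
qed

lemma integral_density_bounded:
  fixes f :: "'a \<Rightarrow> 'b::{banach, second_countable_topology}"
  assumes "integrable S d" "\<And>x. 0 \<le> d x" "f \<in> borel_measurable S" "\<And>x. norm (f x) \<le> B"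
  shows "integrable S (\<lambda>x. d x *\<^sub>R f x)" 
    "(\<integral>x. f x \<partial>density S (\<lambda>x. ennreal (d x))) = (\<integral>x. d x *\<^sub>R f x \<partial>S)"
proof -
  have B: "0 \<le> B" using assms(4) norm_ge_zero order_trans by blast
  have "norm (d x *\<^sub>R f x) \<le> norm (B * d x)" for x
    using mult_left_mono[OF assms(4), of "d x"] assms(2)[of x] B by (simp add: mult.commute)
  then show "integrable S (\<lambda>x. d x *\<^sub>R f x)"
    using assms by (intro Bochner_Integration.integrable_bound[where g="\<lambda>x. d x *\<^sub>R f x" and f="\<lambda>x. B * d x"]) auto
  show "(\<integral>x. f x \<partial>density S (\<lambda>x. ennreal (d x))) = (\<integral>x. d x *\<^sub>R f x \<partial>S)"
    using assms by (intro integral_density) auto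
qed

text \<open>The four Jordan pieces receive densities \<open>d 0\<close> to \<open>d 3\<close> over
  one finite measure, and \<open>u\<close> recombines them with the signs and the factor \<i> of
  \<open>cm_integral\<close>. The base \<open>N\<close> need not be the total variation: nothing is
  claimed about the modulus of \<open>u\<close>.\<close>

lemma complex_measure_density:
  assumes \<mu>: "complex_measure M \<mu>"
  obtains N and u :: "'a \<Rightarrow> complex" where "finite_measure N" "sets N = sets M" "integrable N u"
    "\<And>A. A \<in> sets M \<Longrightarrow> \<mu> A = (\<integral>x. indicator A x *\<^sub>R u x \<partial>N)"
    "\<And>f. f \<in> borel_measurable M \<Longrightarrow> bounded (range f) \<Longrightarrow>
       cm_integral M \<mu> f = (\<integral>x. f x * u x \<partial>N)"
proof -
  note Re = complex_measure_signed(1)[OF \<mu>] and Im = complex_measure_signed(2)[OF \<mu>]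
  define D where "D = (\<lambda>j::nat. pos_variation M (if j = 0 then (\<lambda>A. Re (\<mu> A)) else
    if j = 1 then (\<lambda>A. - Re (\<mu> A)) else if j = 2 then (\<lambda>A. Im (\<mu> A)) else (\<lambda>A. - Im (\<mu> A))))"
  have fin: "finite_measure (D j)" for j
    unfolding D_def by (intro finite_measure_pos_variation)
      (auto intro: Re Im signed_measure_uminus)
  have setsD: "sets (D j) = sets M" for j by (simp add: D_def)
  obtain S d where S: "finite_measure S" "sets S = sets M"
    and d: "\<And>j. j \<in> {..<4} \<Longrightarrow> integrable S (d j)" "\<And>j x. j \<in> {..<4::nat} \<Longrightarrow> 0 \<le> d j x"
    "\<And>j. j \<in> {..<4} \<Longrightarrow> D j = density S (\<lambda>x. ennreal (d j x))"
    by (rule finite_measures_common_density[OF finite_lessThan[of 4] fin setsD]) (rule that)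
  define u where "u x = complex_of_real (d 0 x - d 1 x) + \<i> * complex_of_real (d 2 x - d 3 x)" for x
  have [measurable_cong]: "sets S = sets M" by fact
  have u: "integrable S u"
    unfolding u_def using d(1) by (intro Bochner_Integration.integrable_add integrable_mult_right
       integrable_of_real Bochner_Integration.integrable_diff) auto
  have cm: "(integral\<^sup>L (D 0) f - integral\<^sup>L (D 1) f) + \<i> * (integral\<^sup>L (D 2) f - integral\<^sup>L (D 3) f)
     = (\<integral>x. f x * u x \<partial>S)"
    if f: "f \<in> borel_measurable M" "\<And>x. cmod (f x) \<le> B" for f B
  proof -
    have int: "integrable S (\<lambda>x. d j x *\<^sub>R f x)" "integral\<^sup>L (D j) f = (\<integral>x. d j x *\<^sub>R f x \<partial>S)"
      if "j < 4" for j
      using integral_density_bounded[of S "d j" f B] d[of j] f that S(2) by auto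
    have "(\<integral>x. f x * u x \<partial>S) = (\<integral>x. (d 0 x *\<^sub>R f x - d 1 x *\<^sub>R f x) +
        \<i> * (d 2 x *\<^sub>R f x - d 3 x *\<^sub>R f x) \<partial>S)"
      by (intro Bochner_Integration.integral_cong) (auto simp: u_def algebra_simps scaleR_conv_of_real)
    then show ?thesis using int by simp
  qed
  have "\<mu> A = (\<integral>x. indicator A x *\<^sub>R u x \<partial>S)" if A: "A \<in> sets M" for A
  proof -
    have *: "(\<integral>x. indicator A x \<partial>D j) = complex_of_real (measure (D j) A)" for j
    proof -
      interpret finite_measure "D j" by (rule fin)
      have "A \<inter> space (D j) = A" using sets.sets_into_space[OF A] by (auto simp: D_def)
      moreover have "(\<integral>x. indicator A x \<partial>D j) = (\<integral>x. complex_of_real (indicator A x) \<partial>D j)"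
        by (intro Bochner_Integration.integral_cong) (auto simp: indicator_def)
      ultimately show ?thesis by simp
    qed
    have "\<mu> A = complex_of_real (Re (\<mu> A)) + \<i> * complex_of_real (Im (\<mu> A))"
      by (rule complex_eq)
    also have "\<dots> = (\<integral>x. indicator A x * u x \<partial>S)"
      unfolding Jordan_decomposition[OF Re A] Jordan_decomposition[OF Im A] using A
      by (subst cm[symmetric, where B=1]) (simp_all add: *, simp_all add: D_def indicator_def)
    also have "\<dots> = (\<integral>x. indicator A x *\<^sub>R u x \<partial>S)"
      by (intro Bochner_Integration.integral_cong) (auto simp: indicator_def)
    finally show ?thesis .
  qed
  moreover have "cm_integral M \<mu> f = (\<integral>x. f x * u x \<partial>S)"
    if f: "f \<in> borel_measurable M" "bounded (range f)" for f
  proof -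
    obtain B where "\<And>x. cmod (f x) \<le> B" using f(2) by (auto simp: bounded_iff)
    from cm[OF f(1) this] show ?thesis by (simp add: cm_integral_def D_def)
  qed
  ultimately show ?thesis using that S u by blast
qed

section \<open>Uniqueness of Fourier transforms of complex densities\<close>

text \<open>Levy's theorem speaks of positive measures. Sums are needed in order to rewrite an
  equality of differences P - Q = P' - Q' as the equality P + Q' = P' + Q of positive
  measures.\<close>

lemma finite_measure_add:
  assumes P: "finite_measure P" "sets P = sets M" and Q: "finite_measure Q" "sets Q = sets M"
  obtains R where "finite_measure R" "sets R = sets M"
    "\<And>f B. f \<in> borel_measurable M \<Longrightarrow> (\<And>x. cmod (f x) \<le> B) \<Longrightarrow>
       integral\<^sup>L R f = integral\<^sup>L P f + integral\<^sup>L Q f"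
proof -
  define D where "D b = (if b then P else Q)" for b
  obtain S d where S: "finite_measure S" "sets S = sets M"
    and d: "\<And>j. j \<in> UNIV \<Longrightarrow> integrable S (d j)" "\<And>j x. j \<in> UNIV \<Longrightarrow> 0 \<le> d j x"
    "\<And>j. j \<in> UNIV \<Longrightarrow> D j = density S (\<lambda>x. ennreal (d j x))"
    by (rule finite_measures_common_density[of UNIV D M]) (auto simp: D_def P Q)
  define R where "R = density S (\<lambda>x. ennreal (d True x + d False x))"
  have int: "integrable S (\<lambda>x. d True x + d False x)" using d by auto
  have "emeasure R (space R) = (\<integral>\<^sup>+x. ennreal (d True x + d False x) \<partial>S)"
    unfolding R_def using int
    by (subst emeasure_density) (auto intro!: nn_integral_cong)
  also have "\<dots> = ennreal (\<integral>x. d True x + d False x \<partial>S)"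
    using int d by (intro nn_integral_eq_integral) auto
  finally have "emeasure R (space R) = ennreal (\<integral>x. d True x + d False x \<partial>S)" .
  then have "finite_measure R" by (intro finite_measureI) simp
  moreover have "integral\<^sup>L R f = integral\<^sup>L P f + integral\<^sup>L Q f" 
    if f: "f \<in> borel_measurable M" "\<And>x. cmod (f x) \<le> B" for f B
  proof -
    have f': "f \<in> borel_measurable S" using f S(2) by (simp cong: measurable_cong_sets)
    note 1 = integral_density_bounded[OF d(1) d(2) f' f(2)]
    have "integral\<^sup>L R f = (\<integral>x. d True x *\<^sub>R f x + d False x *\<^sub>R f x \<partial>S)"
      unfolding R_def using d
      by (subst integral_density_bounded(2)[OF int _ f' f(2)]) (auto simp: scaleR_add_left)
    also have "\<dots> = (\<integral>x. d True x *\<^sub>R f x \<partial>S) + (\<integral>x. d False x *\<^sub>R f x \<partial>S)"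
      using 1 by simp
    also have "\<dots> = integral\<^sup>L (D True) f + integral\<^sup>L (D False) f"
      using 1(2)[of True] 1(2)[of False] d(3) by simp
    finally show ?thesis by (simp add: D_def)
  qed
  ultimately show ?thesis using that S(2) by (metis R_def sets_density)
qed

text \<open>The value of \<open>char\<close> at 0 is the total mass, so both masses are the same m
  and one rescaling by 1/m reduces to probability measures. Mass 0 cannot be normalized and is
  treated apart.\<close>

lemma finite_measure_char_unique:
  fixes P Q :: "real measure"
  assumes P: "finite_measure P" "sets P = sets borel" and Q: "finite_measure Q" "sets Q = sets borel"
    and char: "\<And>t. char P t = char Q t"
  shows "P = Q"
proof -
  interpret P: finite_measure P by fact
  interpret Q: finite_measure Q by fact
  have sp: "space P = UNIV" "space Q = UNIV"
    using P(2) Q(2) by (auto dest: sets_eq_imp_space_eq)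
  define m where "m = measure P UNIV"
  have mP: "emeasure P UNIV = ennreal m" by (simp add: m_def P.emeasure_eq_measure)
  have "complex_of_real (measure P UNIV) = complex_of_real (measure Q UNIV)"
    using char[of 0] sp by (simp add: char_def)
  then have mQ: "emeasure Q UNIV = ennreal m" by (simp add: m_def Q.emeasure_eq_measure)
  show ?thesis
  proof (cases "m = 0")
    case True
    have "emeasure P A = 0" "emeasure Q A = 0" for A
      using mP mQ True emeasure_mono[of A UNIV P] emeasure_mono[of A UNIV Q] P(2) Q(2) 
      by (auto simp: top_unique)
    then show ?thesis using P Q by (intro measure_eqI) auto
  next
    case False
    then have m: "m > 0" using m_def by (simp add: zero_less_measure_iff measure_nonneg less_le)
    have rd: "real_distribution (density X (\<lambda>_. ennreal (1 / m)))"
      and ch: "char (density X (\<lambda>_. ennreal (1 / m))) t = (1 / m) *\<^sub>R char X t"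
      if X: "sets X = sets borel" "emeasure X UNIV = ennreal m" for X :: "real measure" and t
    proof -
      have spX: "space X = UNIV" using sets_eq_imp_space_eq[OF X(1)] by simp
      have [measurable_cong]: "sets X = sets borel" by fact
      show "real_distribution (density X (\<lambda>_. ennreal (1 / m)))"
        unfolding real_distribution_def real_distribution_axioms_def using X m spX
        by (auto intro!: prob_spaceI simp: emeasure_density_const simp flip: ennreal_mult')
      show "char (density X (\<lambda>_. ennreal (1 / m))) t = (1 / m) *\<^sub>R char X t"
        unfolding char_def using m by (subst integral_density) auto
    qed
    have "density P (\<lambda>_. ennreal (1 / m)) = density Q (\<lambda>_. ennreal (1 / m))"
      using rd[OF P(2) mP] rd[OF Q(2) mQ] ch[OF P(2) mP] ch[OF Q(2) mQ] char
      by (intro Levy_uniqueness) (auto intro!: ext)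
    then have "ennreal (1 / m) * emeasure P A = ennreal (1 / m) * emeasure Q A" if "A \<in> sets P" for A
      using that P Q by (metis emeasure_density_const)
    then have "emeasure P A = emeasure Q A" if "A \<in> sets P" for A
      using that m by (metis ennreal_mult_cancel_left divide_pos_pos ennreal_eq_0_iff ennreal_neq_top leD zero_less_one)
    then show ?thesis using P Q by (intro measure_eqI) auto
  qed
qed

lemma distr_density:
  fixes f :: "'a \<Rightarrow> real"
  assumes f: "integrable M f" "\<And>x. 0 \<le> f x" and X[measurable]: "X \<in> M \<rightarrow>\<^sub>M L"
  shows "finite_measure (distr (density M (\<lambda>x. ennreal (f x))) L X)"
    "\<And>g::'b \<Rightarrow> complex. g \<in> borel_measurable L \<Longrightarrow>
       integral\<^sup>L (distr (density M (\<lambda>x. ennreal (f x))) L X) g = (\<integral>x. f x *\<^sub>R g (X x) \<partial>M)"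
proof -
  have [measurable]: "f \<in> borel_measurable M" using f by auto
  have "emeasure (density M (\<lambda>x. ennreal (f x))) (space M) = ennreal (\<integral>x. f x \<partial>M)"
    using f by (subst emeasure_density)
      (auto simp: nn_integral_eq_integral[symmetric] intro!: nn_integral_cong)
  then have "finite_measure (density M (\<lambda>x. ennreal (f x)))" by (intro finite_measureI) simp
  then show "finite_measure (distr (density M (\<lambda>x. ennreal (f x))) L X)"
    by (rule finite_measure.finite_measure_distr) simp
  show "integral\<^sup>L (distr (density M (\<lambda>x. ennreal (f x))) L X) g = (\<integral>x. f x *\<^sub>R g (X x) \<partial>M)"
    if [measurable]: "g \<in> borel_measurable L" for g :: "'b \<Rightarrow> complex"
    using f by (subst integral_distr) (auto intro!: integral_density)
qed

lemma integrable_mult_bounded: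
  fixes f g :: "'a \<Rightarrow> complex"
  assumes "integrable M f" "g \<in> borel_measurable M" "\<And>x. cmod (g x) \<le> B"
  shows "integrable M (\<lambda>x. f x * g x)"
proof -
  have "0 \<le> B" using assms(3) norm_ge_zero order_trans by blast
  then have "cmod (f x * g x) \<le> norm (B *\<^sub>R f x)" for x
    using mult_left_mono[OF assms(3)[of x], of "cmod (f x)"] by (simp add: norm_mult mult.commute)
  then show ?thesis using assms
    by (intro Bochner_Integration.integrable_bound[where g="\<lambda>x. f x * g x" and f="\<lambda>x. B *\<^sub>R f x"]) auto
qed

text \<open>Positive and negative parts of the two densities push forward to four positive measures
  on the line. Moving the negative parts across the equation leaves two positive measures
  \<open>R\<close> and \<open>R'\<close> with equal characteristic functions.\<close>

lemma pushforward_unique_real: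
  fixes F :: "'a \<Rightarrow> real" and F' :: "'b \<Rightarrow> real"
  assumes F: "integrable M F" and X[measurable]: "X \<in> borel_measurable M"
    and F': "integrable M' F'" and X'[measurable]: "X' \<in> borel_measurable M'"
    and eq: "\<And>t. (\<integral>x. complex_of_real (F x) * iexp (t * X x) \<partial>M) = (\<integral>x. complex_of_real (F' x) * iexp (t * X' x) \<partial>M')"
    and A[measurable]: "A \<in> sets borel"
  shows "(\<integral>x. complex_of_real (F x) * indicator A (X x) \<partial>M) = (\<integral>x. complex_of_real (F' x) * indicator A (X' x) \<partial>M')"
proof -
  define P where "P = distr (density M (\<lambda>x. ennreal (max 0 (F x)))) borel X"
  define Q where "Q = distr (density M (\<lambda>x. ennreal (max 0 (- F x)))) borel X"
  define P' where "P' = distr (density M' (\<lambda>x. ennreal (max 0 (F' x)))) borel X'"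
  define Q' where "Q' = distr (density M' (\<lambda>x. ennreal (max 0 (- F' x)))) borel X'"
  note defs = P_def Q_def P'_def Q'_def
  have int: "integrable M (\<lambda>x. max 0 (F x))" "integrable M (\<lambda>x. max 0 (- F x))" 
       "integrable M' (\<lambda>x. max 0 (F' x))" "integrable M' (\<lambda>x. max 0 (- F' x))" 
    using F F' by auto
  have fin: "finite_measure P" "finite_measure Q" "finite_measure P'" "finite_measure Q'"
    unfolding defs using int by (auto intro!: distr_density)
  have sets: "sets P = sets borel" "sets Q = sets borel" "sets P' = sets borel" "sets Q' = sets borel"
    by (auto simp: defs)
  have diff: "integral\<^sup>L P g - integral\<^sup>L Q g = (\<integral>x. complex_of_real (F x) * g (X x) \<partial>M)"
    "integral\<^sup>L P' g - integral\<^sup>L Q' g = (\<integral>x. complex_of_real (F' x) * g (X' x) \<partial>M')"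
    if g: "g \<in> borel_measurable borel" "\<And>x. cmod (g x) \<le> 1" for g
  proof -
    have D: "(\<integral>y. max 0 (f y) *\<^sub>R g (Y y) \<partial>N) - (\<integral>y. max 0 (- f y) *\<^sub>R g (Y y) \<partial>N)
       = (\<integral>x. complex_of_real (f x) * g (Y x) \<partial>N)"
      if f: "integrable N f" and Y[measurable]: "Y \<in> borel_measurable N" for N :: "'c measure" and f Y
    proof -
      have "g \<circ> Y \<in> borel_measurable N" using Y g(1) by (rule measurable_comp)
      then have gY: "(\<lambda>x. g (Y x)) \<in> borel_measurable N" by (simp add: comp_def)
      have i: "integrable N (\<lambda>y. max 0 (f y) *\<^sub>R g (Y y))" "integrable N (\<lambda>y. max 0 (- f y) *\<^sub>R g (Y y))"
        unfolding scaleR_conv_of_real using f g gY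
        by (auto intro!: integrable_mult_bounded[where B=1])
      have "(\<integral>y. max 0 (f y) *\<^sub>R g (Y y) - max 0 (- f y) *\<^sub>R g (Y y) \<partial>N) = (\<integral>x. complex_of_real (f x) * g (Y x) \<partial>N)"
        by (intro Bochner_Integration.integral_cong refl) (auto simp: max_def scaleR_conv_of_real)
      then show ?thesis using i by simp
    qed
    show "integral\<^sup>L P g - integral\<^sup>L Q g = (\<integral>x. complex_of_real (F x) * g (X x) \<partial>M)"
      using D[OF F X] g int unfolding defs by (subst (1 2) distr_density(2)) auto
    show "integral\<^sup>L P' g - integral\<^sup>L Q' g = (\<integral>x. complex_of_real (F' x) * g (X' x) \<partial>M')"
      using D[OF F' X'] g int unfolding defs by (subst (1 2) distr_density(2)) auto
  qed
  obtain R where R: "finite_measure R" "sets R = sets borel"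
    "\<And>f B. f \<in> borel_measurable borel \<Longrightarrow> (\<And>x. cmod (f x) \<le> B) \<Longrightarrow>
       integral\<^sup>L R f = integral\<^sup>L P f + integral\<^sup>L Q' f"
    by (rule finite_measure_add[of P borel Q']) (use fin sets in auto)
  obtain R' where R': "finite_measure R'" "sets R' = sets borel"
    "\<And>f B. f \<in> borel_measurable borel \<Longrightarrow> (\<And>x. cmod (f x) \<le> B) \<Longrightarrow>
       integral\<^sup>L R' f = integral\<^sup>L P' f + integral\<^sup>L Q f"
    by (rule finite_measure_add[of P' borel Q]) (use fin sets in auto)
  have "R = R'"
  proof (rule finite_measure_char_unique[OF R(1,2) R'(1,2)])
    fix t
    let ?g = "\<lambda>x. iexp (t * x)"
    have g: "?g \<in> borel_measurable borel" "\<And>x. cmod (?g x) \<le> 1" by auto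
    have "integral\<^sup>L P ?g - integral\<^sup>L Q ?g = integral\<^sup>L P' ?g - integral\<^sup>L Q' ?g"
      unfolding diff(1)[OF g] diff(2)[OF g] by (rule eq)
    then show "char R t = char R' t"
      unfolding char_def R(3)[OF g] R'(3)[OF g] by (simp add: algebra_simps)
  qed
  let ?g = "\<lambda>x. indicator A x :: complex"
  have g: "?g \<in> borel_measurable borel" "\<And>x. cmod (?g x) \<le> 1" by (auto simp: indicator_def)
  have "integral\<^sup>L P ?g + integral\<^sup>L Q' ?g = integral\<^sup>L P' ?g + integral\<^sup>L Q ?g"
    using R(3)[OF g] R'(3)[OF g] \<open>R = R'\<close> by simp
  then have "integral\<^sup>L P ?g - integral\<^sup>L Q ?g = integral\<^sup>L P' ?g - integral\<^sup>L Q' ?g"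
    by (simp add: algebra_simps)
  then show ?thesis unfolding diff(1)[OF g] diff(2)[OF g] .
qed

text \<open>Conjugation turns the character at t into the one at -t, so the transforms of F at t and
  -t together determine those of its real and imaginary part. The two base spaces may differ because
  one measure will live on the line and the other on circle times integers.\<close>

lemma pushforward_unique:
  fixes F :: "'a \<Rightarrow> complex" and F' :: "'b \<Rightarrow> complex"
  assumes F: "integrable M F" and X[measurable]: "X \<in> borel_measurable M"
    and F': "integrable M' F'" and X'[measurable]: "X' \<in> borel_measurable M'"
    and eq: "\<And>t. (\<integral>x. F x * iexp (t * X x) \<partial>M) = (\<integral>x. F' x * iexp (t * X' x) \<partial>M')"
    and A[measurable]: "A \<in> sets borel"
  shows "(\<integral>x. F x * indicator A (X x) \<partial>M) = (\<integral>x. F' x * indicator A (X' x) \<partial>M')"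
proof -
  have split: "(\<integral>x. of_real (Re (G x)) * g (Y x) \<partial>N) = ((\<integral>x. G x * g (Y x) \<partial>N) + cnj (\<integral>x. G x * cnj (g (Y x)) \<partial>N)) / 2"
       "(\<integral>x. of_real (Im (G x)) * g (Y x) \<partial>N) = ((\<integral>x. G x * g (Y x) \<partial>N) - cnj (\<integral>x. G x * cnj (g (Y x)) \<partial>N)) / (2 * \<i>)"
       "(\<integral>x. G x * g (Y x) \<partial>N) = (\<integral>x. of_real (Re (G x)) * g (Y x) \<partial>N) + \<i> * (\<integral>x. of_real (Im (G x)) * g (Y x) \<partial>N)"
    if G: "integrable N G" and Y[measurable]: "Y \<in> borel_measurable N" 
      and g[measurable]: "g \<in> borel_measurable borel" and g1: "\<And>x. cmod (g x) \<le> 1"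
    for N :: "'c measure" and G g and Y :: "'c \<Rightarrow> real"
  proof -
    have i: "integrable N (\<lambda>x. G x * g (Y x))" "integrable N (\<lambda>x. cnj (G x) * g (Y x))"
      using G g1 by (auto intro!: integrable_mult_bounded[where B=1])
    have c: "cnj (\<integral>x. G x * cnj (g (Y x)) \<partial>N) = (\<integral>x. cnj (G x) * g (Y x) \<partial>N)"
      by (simp flip: Bochner_Integration.integral_cnj)
    have "((\<integral>x. G x * g (Y x) \<partial>N) + (\<integral>x. cnj (G x) * g (Y x) \<partial>N)) / 2 = (\<integral>x. (G x * g (Y x) + cnj (G x) * g (Y x)) / 2 \<partial>N)"
      using i by simp
    also have "\<dots> = (\<integral>x. of_real (Re (G x)) * g (Y x) \<partial>N)"
      by (intro Bochner_Integration.integral_cong refl)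
        (simp add: complex_add_cnj flip: distrib_right)
    finally show re: "(\<integral>x. of_real (Re (G x)) * g (Y x) \<partial>N) = ((\<integral>x. G x * g (Y x) \<partial>N) + cnj (\<integral>x. G x * cnj (g (Y x)) \<partial>N)) / 2"
      using c by simp
    have "((\<integral>x. G x * g (Y x) \<partial>N) - (\<integral>x. cnj (G x) * g (Y x) \<partial>N)) / (2 * \<i>) = (\<integral>x. (G x * g (Y x) - cnj (G x) * g (Y x)) / (2 * \<i>) \<partial>N)"
      using i by simp
    also have "\<dots> = (\<integral>x. of_real (Im (G x)) * g (Y x) \<partial>N)"
      by (intro Bochner_Integration.integral_cong refl)
        (simp add: complex_diff_cnj divide_eq_eq mult_ac del: divide_divide_eq_left flip: left_diff_distrib)
    finally show im: "(\<integral>x. of_real (Im (G x)) * g (Y x) \<partial>N) = ((\<integral>x. G x * g (Y x) \<partial>N) - cnj (\<integral>x. G x * cnj (g (Y x)) \<partial>N)) / (2 * \<i>)"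
      using c by simp
    show "(\<integral>x. G x * g (Y x) \<partial>N) = (\<integral>x. of_real (Re (G x)) * g (Y x) \<partial>N) + \<i> * (\<integral>x. of_real (Im (G x)) * g (Y x) \<partial>N)"
      unfolding re im by (simp add: field_simps)
  qed
  have e: "(\<lambda>x. iexp (t * x)) \<in> borel_measurable borel" "cmod (iexp (t * x)) \<le> 1" 
    "cnj (iexp (t * x)) = iexp (- t * x)" for t x
    by (auto simp: exp_cnj)
  have i: "(\<lambda>x. indicator A x :: complex) \<in> borel_measurable borel" "cmod (indicator A x) \<le> 1" for x
    by (auto simp: indicator_def)
  have "(\<integral>x. complex_of_real (Re (F x)) * iexp (t * X x) \<partial>M) = (\<integral>x. complex_of_real (Re (F' x)) * iexp (t * X' x) \<partial>M')" for t
    using eq[of t] eq[of "-t"] unfolding split(1)[OF F X e(1,2)] split(1)[OF F' X' e(1,2)] e(3) by simp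
  then have 1: "(\<integral>x. complex_of_real (Re (F x)) * indicator A (X x) \<partial>M) = (\<integral>x. complex_of_real (Re (F' x)) * indicator A (X' x) \<partial>M')"
    using F F' by (intro pushforward_unique_real) auto
  have "(\<integral>x. complex_of_real (Im (F x)) * iexp (t * X x) \<partial>M) = (\<integral>x. complex_of_real (Im (F' x)) * iexp (t * X' x) \<partial>M')" for t
    using eq[of t] eq[of "-t"] unfolding split(2)[OF F X e(1,2)] split(2)[OF F' X' e(1,2)] e(3) by simp
  then have 2: "(\<integral>x. complex_of_real (Im (F x)) * indicator A (X x) \<partial>M) = (\<integral>x. complex_of_real (Im (F' x)) * indicator A (X' x) \<partial>M')"
    using F F' by (intro pushforward_unique_real) auto
  show ?thesis
    using 1 2 unfolding split(3)[OF F X i] split(3)[OF F' X' i] by simp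
qed

section \<open>Poisson summation for the Gaussian\<close>

abbreviation e :: "real \<Rightarrow> complex" where "e t \<equiv> cis (2 * pi * t)"

abbreviation UC :: "real measure" where "UC \<equiv> restrict_space lborel {0..<1}"

abbreviation CZ :: "int measure" where "CZ \<equiv> count_space UNIV"

lemma sigma_finite_CZ: "sigma_finite_measure CZ"
  by (rule sigma_finite_measure_count_space_countable) simp

lemma finite_measure_UC: "finite_measure UC"
  by (rule finite_measureI) (simp add: emeasure_restrict_space space_restrict_space)

lemma e_of_int [simp]: "e (of_int n) = 1"
  using cis_multiple_2pi[of "of_int n"] by (simp add: mult.commute)

lemma e_add: "e (s + t) = e s * e t"
  by (simp add: cis_mult distrib_left)

lemma borel_measurable_cis [measurable]: "cis \<in> borel_measurable borel"
  by (intro borel_measurable_continuous_onI continuous_intros)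

section \<open>Unfolding the real line over circle times integers\<close>

lemma translate_measurable:
  "(\<lambda>(k, x). x + of_int k) \<in> (CZ \<Otimes>\<^sub>M restrict_space lborel {0..<1}) \<rightarrow>\<^sub>M borel"
  by (rule measurable_pair_measure_countable1) (simp_all add: measurable_restrict_space1)

text \<open>[0,1) is a fundamental domain: each real y is x + k for exactly one pair, with k the
  floor of y. After Fubini the sum over k therefore contributes exactly 1 at every y.\<close>

lemma distr_translates:
  "distr (CZ \<Otimes>\<^sub>M UC) borel (\<lambda>(k, x). x + of_int k) = lborel"
proof (rule measure_eqI)
  fix A :: "real set" assume "A \<in> sets (distr (CZ \<Otimes>\<^sub>M UC) borel (\<lambda>(k, x). x + of_int k))"
  then have A[measurable]: "A \<in> sets borel" by simp
  interpret CZ: sigma_finite_measure CZ by (rule sigma_finite_CZ)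
  interpret UC: finite_measure UC by (rule finite_measure_UC)
  interpret PC: pair_sigma_finite lborel CZ by standard
  have floor: "indicator {0..<1} (y - of_int k) = (indicator {\<lfloor>y\<rfloor>} k :: ennreal)" for y :: real and k :: int
  proof -
    have "y - of_int k \<in> {0..<1} \<longleftrightarrow> k = \<lfloor>y\<rfloor>"
      unfolding eq_commute[of k "\<lfloor>y\<rfloor>"] floor_eq_iff by auto
    then show ?thesis by (simp only: indicator_def singleton_iff)
  qed
  have m: "(\<lambda>p. indicator A ((\<lambda>(k, x). x + of_int k) p) :: ennreal) \<in> borel_measurable (CZ \<Otimes>\<^sub>M UC)"
    by (rule measurable_compose[OF translate_measurable borel_measurable_indicator[OF A]])
  have "emeasure (distr (CZ \<Otimes>\<^sub>M UC) borel (\<lambda>(k, x). x + of_int k)) A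
      = (\<integral>\<^sup>+p. indicator A ((\<lambda>(k, x). x + of_int k) p) \<partial>(CZ \<Otimes>\<^sub>M UC))"
    by (subst nn_integral_indicator[symmetric], simp, subst nn_integral_distr[OF translate_measurable]) auto
  also have "\<dots> = (\<integral>\<^sup>+k. \<integral>\<^sup>+x. indicator A (x + of_int k) \<partial>UC \<partial>CZ)"
    using UC.nn_integral_fst[OF m] by simp
  also have "\<dots> = (\<integral>\<^sup>+k. \<integral>\<^sup>+x. indicator A (x + of_int k) * indicator {0..<1} x \<partial>lborel \<partial>CZ)"
    by (intro nn_integral_cong nn_integral_restrict_space) auto
  also have "\<dots> = (\<integral>\<^sup>+k. \<integral>\<^sup>+y. indicator A y * indicator {0..<1} (y - of_int k) \<partial>lborel \<partial>CZ)"
  proof (rule nn_integral_cong)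
    fix k :: int
    show "(\<integral>\<^sup>+x. indicator A (x + of_int k) * indicator {0..<1} x \<partial>lborel)
       = (\<integral>\<^sup>+y. indicator A y * indicator {0..<1} (y - of_int k) \<partial>lborel)"
      by (subst (2) nn_integral_real_affine[where c=1 and t="of_int k"]) (auto simp: add.commute)
  qed
  also have "\<dots> = (\<integral>\<^sup>+y. \<integral>\<^sup>+k. indicator A y * indicator {0..<1} (y - of_int k) \<partial>CZ \<partial>lborel)"
    by (rule PC.Fubini') simp
  also have "\<dots> = (\<integral>\<^sup>+y. indicator A y \<partial>lborel)"
    unfolding floor by (simp add: nn_integral_cmult)
  finally show "emeasure (distr (CZ \<Otimes>\<^sub>M UC) borel (\<lambda>(k, x). x + of_int k)) A = emeasure lborel A"
    by simp
qed simp

lemma nn_integral_periodize: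
  assumes [measurable]: "f \<in> borel_measurable borel"
  shows "(\<integral>\<^sup>+y. f y \<partial>lborel) = (\<integral>\<^sup>+x. \<integral>\<^sup>+k. f (x + of_int k) \<partial>CZ \<partial>UC)"
proof -
  interpret CZ: sigma_finite_measure CZ by (rule sigma_finite_CZ)
  interpret UC: finite_measure UC by (rule finite_measure_UC)
  interpret PC: pair_sigma_finite CZ UC by standard
  have m: "(\<lambda>(k, x). f (x + of_int k)) \<in> borel_measurable (CZ \<Otimes>\<^sub>M UC)"
    using measurable_compose[OF translate_measurable assms] by (simp add: split_def)
  have "(\<integral>\<^sup>+y. f y \<partial>lborel) = (\<integral>\<^sup>+p. f ((\<lambda>(k, x). x + of_int k) p) \<partial>(CZ \<Otimes>\<^sub>M UC))"
    using nn_integral_distr[OF translate_measurable, of f] by (simp add: distr_translates)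
  also have "\<dots> = (\<integral>\<^sup>+x. \<integral>\<^sup>+k. f (x + of_int k) \<partial>CZ \<partial>UC)"
    using m by (subst PC.nn_integral_snd[symmetric]) (simp_all add: split_def)
  finally show ?thesis .
qed

lemma integral_periodize:
  fixes f :: "real \<Rightarrow> complex"
  assumes f: "integrable lborel f"
  shows "integrable (CZ \<Otimes>\<^sub>M UC) (\<lambda>(k, x). f (x + of_int k))"
    "(\<integral>y. f y \<partial>lborel) = (\<integral>x. \<integral>k. f (x + of_int k) \<partial>CZ \<partial>UC)"
proof -
  interpret CZ: sigma_finite_measure CZ by (rule sigma_finite_CZ)
  interpret UC: finite_measure UC by (rule finite_measure_UC)
  interpret PC: pair_sigma_finite CZ UC by standard
  have [measurable]: "f \<in> borel_measurable borel" using f by simp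
  show *: "integrable (CZ \<Otimes>\<^sub>M UC) (\<lambda>(k, x). f (x + of_int k))"
    using f integrable_distr_eq[OF translate_measurable, of f]
    unfolding distr_translates by (simp add: split_def)
  have "(\<integral>y. f y \<partial>lborel) = (\<integral>p. f ((\<lambda>(k, x). x + of_int k) p) \<partial>(CZ \<Otimes>\<^sub>M UC))"
    using integral_distr[OF translate_measurable, of f] unfolding distr_translates by simp
  also have "\<dots> = (\<integral>x. \<integral>k. f (x + of_int k) \<partial>CZ \<partial>UC)"
    using * by (subst PC.integral_snd) (simp_all add: split_def)
  finally show "(\<integral>y. f y \<partial>lborel) = (\<integral>x. \<integral>k. f (x + of_int k) \<partial>CZ \<partial>UC)" .
qed

section \<open>The Gaussian: self-duality and uniform lattice sums\<close>

abbreviation G :: "real \<Rightarrow> real" where "G x \<equiv> exp (- pi * x\<^sup>2)"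

text \<open>\<open>G\<close> is the standard normal density up to the scale c = sqrt(2 \<pi>):
  \<open>G x\<close> is c times the density at c x. Its characteristic function exp(-t^2 / 2), taken
  at t = -c \<theta>, equals \<open>G \<theta>\<close>.\<close>

lemma gaussian_fourier:
  "integrable lborel G" "(\<integral>x. complex_of_real (G x) * e (- \<theta> * x) \<partial>lborel) = of_real (G \<theta>)"
proof -
  let ?c = "sqrt (2 * pi)"
  have c: "?c \<noteq> 0" "?c * ?c = 2 * pi" "?c > 0" by auto
  have sn: "std_normal_density (0 + ?c * x) = G x / ?c" for x
    by (simp add: std_normal_density_def power_mult_distrib)
  have "integrable lborel (\<lambda>x. std_normal_density (0 + ?c * x))"
    by (intro lborel_integrable_real_affine) (auto intro!: integrable_normal_density)
  then have "integrable lborel (\<lambda>x. ?c * (G x / ?c))"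
    unfolding sn by (intro integrable_mult_right) simp
  then show "integrable lborel G" by simp
  have "of_real (G \<theta>) = char std_normal_distribution (- ?c * \<theta>)"
    by (simp add: char_std_normal_distribution power_mult_distrib)
  also have "\<dots> = (\<integral>x. std_normal_density x *\<^sub>R iexp ((- ?c * \<theta>) * x) \<partial>lborel)"
    unfolding char_def by (subst integral_density) auto
  also have "\<dots> = ?c *\<^sub>R (\<integral>x. std_normal_density (0 + ?c * x) *\<^sub>R iexp ((- ?c * \<theta>) * (0 + ?c * x)) \<partial>lborel)"
    by (subst lborel_integral_real_affine[where c = ?c and t=0]) auto
  also have "\<dots> = (\<integral>x. ?c *\<^sub>R (std_normal_density (0 + ?c * x) *\<^sub>R iexp ((- ?c * \<theta>) * (0 + ?c * x))) \<partial>lborel)"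
    by (rule Bochner_Integration.integral_scaleR_right[symmetric])
  also have "\<dots> = (\<integral>x. complex_of_real (G x) * e (- \<theta> * x) \<partial>lborel)"
  proof (intro Bochner_Integration.integral_cong refl)
    fix x
    have "(- ?c * \<theta>) * (0 + ?c * x) = - (?c * ?c) * \<theta> * x" by (simp only: mult_ac mult_minus_left add_0)
    also have "\<dots> = 2 * pi * (- \<theta> * x)" unfolding c by simp
    finally show "?c *\<^sub>R (std_normal_density (0 + ?c * x) *\<^sub>R iexp ((- ?c * \<theta>) * (0 + ?c * x))) = complex_of_real (G x) * e (- \<theta> * x)"
      unfolding sn by (simp only: cis_conv_exp) (simp add: scaleR_conv_of_real)
  qed
  finally show "(\<integral>x. complex_of_real (G x) * e (- \<theta> * x) \<partial>lborel) = of_real (G \<theta>)" by simp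
qed

lemma integrable_int_exp: "integrable CZ (\<lambda>k. exp (3 - 2 * \<bar>real_of_int k\<bar>))"
proof -
  have s: "summable (\<lambda>n. exp (3 - 2 * real n))"
  proof -
    have "exp (3 - 2 * real n) = exp 3 * exp (-2) ^ n" for n
      by (simp add: exp_diff exp_minus field_simps flip: exp_of_nat_mult)
    then show ?thesis by (auto intro!: summable_mult summable_geometric)
  qed
  let ?f = "\<lambda>k. exp (3 - 2 * \<bar>real_of_int k\<bar>)"
  have "integrable (count_space (range int)) ?f"
    using s integrable_bij_count_space[of int UNIV "range int" ?f]
    by (simp add: integrable_count_space_nat_iff bij_betw_def)
  moreover have "integrable (count_space (range (\<lambda>n. - int n))) ?f"
    using s integrable_bij_count_space[of "\<lambda>n. - int n" UNIV "range (\<lambda>n. - int n)" ?f]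
    by (simp add: integrable_count_space_nat_iff bij_betw_def inj_on_def)
  moreover have "k \<in> range int \<union> range (\<lambda>n. - int n)" for k
    by (cases k rule: int_cases2) auto
  then have "range int \<union> range (\<lambda>n. - int n) = UNIV" by blast
  ultimately show ?thesis
    using abs_summable_on_union[of ?f "range int" "range (\<lambda>n. - int n)"]
    by (simp add: Infinite_Set_Sum.abs_summable_on_def)
qed

text \<open>With y = x + k, the chain \<pi> y^2 \<ge> y^2 \<ge> 2 |y| - 1 and |y| \<ge> |k| - 1
  yields the exponent 1 - 2 (|k| - 1) = 3 - 2 |k|. Linear decay in the exponent is enough for a
  geometric majorant.\<close>

lemma G_translate_le:
  assumes "\<bar>x\<bar> \<le> 1" shows "G (x + of_int k) \<le> exp (3 - 2 * \<bar>real_of_int k\<bar>)"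
proof -
  let ?y = "\<bar>x + real_of_int k\<bar>"
  have "2 * ?y - 1 \<le> ?y\<^sup>2"
    using zero_le_power2[of "\<bar>x + real_of_int k\<bar> - 1"] by (simp add: power2_diff)
  also have "\<dots> \<le> pi * ?y\<^sup>2"
    using pi_ge_two mult_right_mono[of 1 pi "?y\<^sup>2"] by simp
  finally have "- (pi * ?y\<^sup>2) \<le> 3 - 2 * \<bar>real_of_int k\<bar>" 
    using assms abs_triangle_ineq4[of "x + of_int k" x] by simp
  then show ?thesis by simp
qed

text \<open>Shifting the index by the floor of \<theta> replaces \<theta> by its fractional part, so
  a single majorant serves all \<theta>. This uniformity gives the Gaussian-weighted periodic
  extension finite mass.\<close>

lemma gaussian_sum:
  "integrable CZ (\<lambda>k. G (\<theta> + of_int k))"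
  "(\<integral>k. G (\<theta> + of_int k) \<partial>CZ) \<le> (\<integral>k. exp (3 - 2 * \<bar>real_of_int k\<bar>) \<partial>CZ)"
proof -
  let ?f = "\<lambda>k. G (frac \<theta> + of_int k)"
  have bij: "bij_betw (\<lambda>k. k + \<lfloor>\<theta>\<rfloor>) UNIV UNIV"
    by (rule bij_betwI[where g="\<lambda>k. k - \<lfloor>\<theta>\<rfloor>"]) auto
  have eq: "G (\<theta> + of_int k) = ?f (k + \<lfloor>\<theta>\<rfloor>)" for k
    by (simp add: frac_def)
  have le: "?f k \<le> exp (3 - 2 * \<bar>real_of_int k\<bar>)" for k
    using frac_lt_1[of \<theta>] frac_ge_0[of \<theta>] by (intro G_translate_le) linarith
  have f: "integrable CZ ?f"
    using le by (intro Bochner_Integration.integrable_bound[OF integrable_int_exp]) auto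
  show "integrable CZ (\<lambda>k. G (\<theta> + of_int k))"
    unfolding eq integrable_bij_count_space[OF bij, where f="?f"] by (rule f)
  show "(\<integral>k. G (\<theta> + of_int k) \<partial>CZ) \<le> (\<integral>k. exp (3 - 2 * \<bar>real_of_int k\<bar>) \<partial>CZ)"
    unfolding eq integral_bij_count_space[OF bij, where f="?f"]
    using f integrable_int_exp le by (intro integral_mono) auto
qed

text \<open>Dominated convergence along sequences; over counting measure this is the Weierstrass
  M-test for series of continuous functions.\<close>

lemma continuous_on_integral_dominated:
  fixes f :: "real \<Rightarrow> 'a \<Rightarrow> complex"
  assumes "\<And>k. k \<in> space N \<Longrightarrow> continuous_on S (\<lambda>x. f x k)" "\<And>x. x \<in> S \<Longrightarrow> f x \<in> borel_measurable N"
    "\<And>x k. x \<in> S \<Longrightarrow> k \<in> space N \<Longrightarrow> cmod (f x k) \<le> w k" "integrable N w"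
  shows "continuous_on S (\<lambda>x. \<integral>k. f x k \<partial>N)"
  unfolding continuous_on_sequentially comp_def
proof (intro allI ballI impI)
  fix X a assume a: "a \<in> S" and X: "(\<forall>n. X n \<in> S) \<and> X \<longlonglongrightarrow> a"
  show "(\<lambda>n. \<integral>k. f (X n) k \<partial>N) \<longlonglongrightarrow> (\<integral>k. f a k \<partial>N)"
  proof (rule integral_dominated_convergence[OF _ _ assms(4)])
    show "AE k in N. (\<lambda>n. f (X n) k) \<longlonglongrightarrow> f a k"
    proof (rule AE_I2)
      fix k assume "k \<in> space N"
      from assms(1)[OF this] show "(\<lambda>n. f (X n) k) \<longlonglongrightarrow> f a k"
        using a X unfolding continuous_on_sequentially comp_def by blast
    qed
  qed (use a X assms in auto)
qed

section \<open>Fourier coefficients of continuous functions on the circle\<close>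

text \<open>The circle is half-open while compactness and the fundamental theorem of calculus want
  the closed interval; the endpoint 1 is a null set.\<close>

lemma UC_continuous:
  fixes f :: "real \<Rightarrow> complex"
  assumes f: "continuous_on {0..1} f"
  shows "integrable UC f" "(\<integral>x. f x \<partial>UC) = (\<integral>x. indicator {0..1} x *\<^sub>R f x \<partial>lborel)"
proof -
  have i: "set_integrable lborel {0..1} f" using f by (rule borel_integrable_atLeastAtMost')
  then have j: "set_integrable lborel {0..<1} f" by (rule set_integrable_subset) auto
  then show "integrable UC f" by (simp add: integrable_restrict_space set_integrable_def)
  have "(\<integral>x. f x \<partial>UC) = (\<integral>x. indicator {0..<1} x *\<^sub>R f x \<partial>lborel)"
    by (simp add: integral_restrict_space)
  also have "\<dots> = (\<integral>x. indicator {0..1} x *\<^sub>R f x \<partial>lborel)"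
    using i j unfolding set_integrable_def
    by (intro integral_cong_AE borel_measurable_integrable)
      (use AE_lborel_singleton[of "1::real"] in \<open>auto elim!: eventually_mono simp: indicator_def\<close>)
  finally show "(\<integral>x. f x \<partial>UC) = (\<integral>x. indicator {0..1} x *\<^sub>R f x \<partial>lborel)" .
qed

lemma integral_e: "(\<integral>x. e (of_int j * x) \<partial>UC) = (if j = 0 then 1 else 0)"
proof (cases "j = 0")
  case True
  have "measure UC (space UC) = 1"
    by (simp add: measure_restrict_space space_restrict_space)
  then show ?thesis using True by simp
next
  case False
  define c where "c = 2 * pi * \<i> * of_int j"
  have c: "c \<noteq> 0" using False by (simp add: c_def)
  have ec: "e (of_int j * x) = exp (c * of_real x)" for x
    by (simp add: cis_conv_exp c_def mult_ac)
  let ?F = "\<lambda>x. exp (c * of_real x) / c"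
  have "(\<integral>x. indicator {0..1} x *\<^sub>R e (of_int j * x) \<partial>lborel) = ?F 1 - ?F 0"
  proof (rule integral_FTC_atLeastAtMost)
    show "(?F has_vector_derivative e (of_int j * x)) (at x within {0..1})" for x
      unfolding ec
      by (rule has_vector_derivative_real_field) (rule derivative_eq_intros | simp add: c)+
  qed (auto intro!: continuous_intros)
  also have "\<dots> = 0" using e_of_int[of j] ec[of 1] by simp
  finally show ?thesis using False
    by (subst UC_continuous) (auto intro!: continuous_intros)
qed

text \<open>
  The vanishing of all Fourier coefficients is stable under multiplication by a polynomial in
  \<open>cos\<close> and \<open>sin\<close>; generality in \<open>E\<close> is what makes the product case of the induction work.
\<close>

lemma polynomial_mult_fourier_zero:
  assumes "real_polynomial_function p"
  shows "continuous_on {0..1} E \<Longrightarrow> (\<And>n::int. (\<integral>x. E x * e (of_int n * x) \<partial>UC) = 0) \<Longrightarrow>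
    (\<integral>x. (of_real (p (e x)) * E x) * e (of_int n * x) \<partial>UC) = 0"
  using assms
proof (induction p arbitrary: E n rule: real_polynomial_function.induct)
  case (linear f)
  interpret bounded_linear f by fact
  \<comment> \<open>The coefficients come from writing cos and sin through e(x) and e(-x). A
    real-linear function of \<open>e x\<close> thus only shifts frequencies by 1 up or down, and all
    coefficients of \<open>E\<close> are known to vanish.\<close>
  define a where "a = of_real (f 1) / 2 + of_real (f \<i>) / (2 * \<i>)"
  define b where "b = of_real (f 1) / 2 - of_real (f \<i>) / (2 * \<i>)"
  have f: "of_real (f (e x)) = a * e x + b * e (- x)" for x
  proof -
    have "e x = cos (2 * pi * x) *\<^sub>R 1 + sin (2 * pi * x) *\<^sub>R \<i>"
      by (simp add: complex_eq_iff)
    then have "f (e x) = cos (2 * pi * x) * f 1 + sin (2 * pi * x) * f \<i>"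
      by (simp only: add scaleR) simp
    then show ?thesis
      by (simp add: complex_eq_iff a_def b_def field_simps)
  qed
  have eq: "(of_real (f (e x)) * E x) * e (of_int n * x) =
      a * (E x * e (of_int (n + 1) * x)) + b * (E x * e (of_int (n - 1) * x))" for x
  proof -
    have "e (of_int (n + 1) * x) = e x * e (of_int n * x)" "e (of_int (n - 1) * x) = e (- x) * e (of_int n * x)"
      using e_add[of x "of_int n * x"] e_add[of "- x" "of_int n * x"] by (simp_all add: algebra_simps)
    then show ?thesis unfolding f by (simp add: algebra_simps)
  qed
  have i: "integrable UC (\<lambda>x. E x * e (of_int m * x))" for m :: int
    using linear.prems(1) by (intro UC_continuous continuous_intros)
  show ?case unfolding eq using i[of "n + 1"] i[of "n - 1"] linear.prems(2)[of "n + 1"] linear.prems(2)[of "n - 1"] by simp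
next
  case (const c)
  then show ?case by (simp add: mult.assoc)
next
  case (add p q)
  have "continuous_on {0..1} (\<lambda>x. r (e x))" if "real_polynomial_function r" for r :: "complex \<Rightarrow> real"
    using that unfolding real_polynomial_function_eq
    by (intro continuous_on_compose2[OF continuous_on_polymonial_function[of r UNIV]] continuous_intros) auto
  then have "integrable UC (\<lambda>x. of_real (r (e x)) * E x * e (of_int n * x))" 
    if "real_polynomial_function r" for r :: "complex \<Rightarrow> real"
    using add.prems that by (intro UC_continuous continuous_intros) auto
  then show ?case
    using add by (simp add: distrib_right)
next
  case (mult p q)
  have "continuous_on {0..1} (\<lambda>x. r (e x))" if "real_polynomial_function r" for r :: "complex \<Rightarrow> real"
    using that unfolding real_polynomial_function_eq
    by (intro continuous_on_compose2[OF continuous_on_polymonial_function[of r UNIV]] continuous_intros) auto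
  then have "continuous_on {0..1} (\<lambda>x. of_real (q (e x)) * E x)"
    using mult by (intro continuous_intros) auto
  from mult.IH(1)[OF this mult.IH(2)[OF mult.prems]] show ?case
    by (simp add: mult.assoc)
qed

text \<open>By Stone-Weierstrass the conjugate of \<open>D\<close> is uniformly within \<epsilon> of
  a polynomial g in the point \<open>e x\<close> of the unit circle. Since D g integrates to 0, the
  integral of |D|^2 is at most B \<epsilon>, for every \<epsilon>.\<close>

lemma fourier_uniqueness:
  fixes D :: "real \<Rightarrow> complex"
  assumes D: "continuous_on {0..1} D" "D 0 = D 1"
    and zero: "\<And>n::int. (\<integral>x. D x * e (of_int n * x) \<partial>UC) = 0"
    and x: "x \<in> {0..1}"
  shows "D x = 0"
proof -
  define f where "f = D \<circ> (\<lambda>z. Arg2pi z / (2 * pi))"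
  \<comment> \<open>\<open>D 0 = D 1\<close> makes \<open>D\<close> a loop, so it descends to the
    unit circle. The trivial homotopy from \<open>D\<close> to itself is used only to obtain
    continuity of \<open>f\<close>, including at the point where the angle jumps.\<close>
  have "homotopic_loops UNIV D D"
    using D by (simp add: homotopic_loops_refl path_def pathfinish_def pathstart_def)
  then have "homotopic_with_canon (\<lambda>h. True) (sphere 0 1) UNIV f f"
    unfolding f_def by (rule homotopic_loops_imp_homotopic_circlemaps)
  then have f: "continuous_on (sphere 0 1) f"
    by (rule homotopic_with_imp_continuous[THEN conjunct1])
  \<comment> \<open>\<open>Arg2pi\<close> takes values in [0, 2 \<pi>), so the identity is read off
    on the half-open interval, which is the space of \<open>UC\<close>.\<close>
  have fe: "f (e x) = D x" if "x \<in> {0..<1}" for x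
  proof -
    have "Arg2pi (e x) = 2 * pi * x"
      using that by (intro Arg2pi_unique[where r=1]) (auto simp: cis_conv_exp)
    then show ?thesis by (simp add: f_def)
  qed
  have "bounded (D ` {0..1})"
    by (intro compact_imp_bounded compact_continuous_image D compact_Icc)
  then obtain B where B: "\<And>x. x \<in> {0..1} \<Longrightarrow> cmod (D x) \<le> B"
    unfolding bounded_iff by blast
  have D2: "integrable UC (\<lambda>x. D x * cnj (D x))"
    using D by (intro UC_continuous continuous_intros)
  have sq: "cmod (\<integral>x. D x * cnj (D x) \<partial>UC) \<le> B * \<epsilon>" if \<epsilon>: "0 < \<epsilon>" for \<epsilon>
  proof -
    have cf: "continuous_on (sphere 0 1) (\<lambda>z. cnj (f z))" using f by (intro continuous_intros)
    obtain g where g: "polynomial_function g" "\<And>z. z \<in> sphere 0 1 \<Longrightarrow> cmod (cnj (f z) - g z) < \<epsilon>"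
      using Stone_Weierstrass_polynomial_function[OF compact_sphere cf \<epsilon>] by blast
    have rg: "real_polynomial_function (\<lambda>z. Re (g z))" "real_polynomial_function (\<lambda>z. Im (g z))"
      using g(1)[unfolded polynomial_function_def, rule_format, OF bounded_linear_Re]
        g(1)[unfolded polynomial_function_def, rule_format, OF bounded_linear_Im]
      by (simp_all add: comp_def)
    have cg: "continuous_on {0..1} (\<lambda>x. g (e x))"
      by (intro continuous_on_compose2[OF continuous_on_polymonial_function[OF g(1), of UNIV]] continuous_intros) auto
    have i: "integrable UC (\<lambda>x. of_real (Re (g (e x))) * D x)" "integrable UC (\<lambda>x. of_real (Im (g (e x))) * D x)"
      "integrable UC (\<lambda>x. D x * g (e x))"
      using D cg by (auto intro!: UC_continuous continuous_intros)
    \<comment> \<open>The preceding lemma treats real polynomials, so g is split into real and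
      imaginary part; frequency 0 gives the plain integral.\<close>
    have "(\<integral>x. D x * g (e x) \<partial>UC) = (\<integral>x. of_real (Re (g (e x))) * D x + \<i> * (of_real (Im (g (e x))) * D x) \<partial>UC)"
      by (intro Bochner_Integration.integral_cong refl) (simp add: complex_eq_iff algebra_simps)
    also have "\<dots> = 0"
      using i polynomial_mult_fourier_zero[OF rg(1) D(1) zero, of 0] 
        polynomial_mult_fourier_zero[OF rg(2) D(1) zero, of 0] by simp
    finally have "(\<integral>x. D x * cnj (D x) \<partial>UC) = (\<integral>x. D x * cnj (D x) - D x * g (e x) \<partial>UC)"
      using D2 i by simp
    also have "cmod \<dots> \<le> (\<integral>x. cmod (D x * cnj (D x) - D x * g (e x)) \<partial>UC)"
      by (rule integral_norm_bound)
    also have "\<dots> \<le> (\<integral>x. B * \<epsilon> \<partial>UC)"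
    proof (rule integral_mono)
      interpret finite_measure UC by (rule finite_measure_UC)
      show "integrable UC (\<lambda>x. B * \<epsilon>)" by simp
      fix x assume "x \<in> space UC"
      then have x: "x \<in> {0..<1}" by (simp add: space_restrict_space)
      have "cmod (D x * cnj (D x) - D x * g (e x)) = cmod (D x) * cmod (cnj (f (e x)) - g (e x))"
        unfolding fe[OF x] norm_mult[symmetric] by (simp add: right_diff_distrib)
      also have "\<dots> \<le> B * \<epsilon>"
        using less_imp_le[OF g(2)[of "e x"]] B[of x] x order_trans[OF norm_ge_zero B[of x]]
        by (intro mult_mono) auto
      finally show "cmod (D x * cnj (D x) - D x * g (e x)) \<le> B * \<epsilon>" .
    qed (rule integrable_norm, rule Bochner_Integration.integrable_diff[OF D2 i(3)])
    also have "\<dots> = B * \<epsilon>" 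
      by (simp add: measure_restrict_space space_restrict_space)
    finally show ?thesis .
  qed
  have "cmod (\<integral>x. D x * cnj (D x) \<partial>UC) \<le> 0"
  proof (rule tendsto_lowerbound)
    have "((\<lambda>\<epsilon>. B * \<epsilon>) \<longlongrightarrow> B * 0) (at_right 0)"
      by (intro tendsto_intros)
    then show "((\<lambda>\<epsilon>. B * \<epsilon>) \<longlongrightarrow> 0) (at_right 0)" by simp
    show "\<forall>\<^sub>F \<epsilon> in at_right 0. cmod (\<integral>x. D x * cnj (D x) \<partial>UC) \<le> B * \<epsilon>"
      by (rule eventually_mono[OF eventually_at_right_less[of "0::real"]]) (rule sq)
  qed simp
  then have z: "(\<integral>x. indicator {0..1} x *\<^sub>R (D x * cnj (D x)) \<partial>lborel) = 0"
    using D by (subst (asm) UC_continuous(2)) (auto intro!: continuous_intros)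
  have "(\<integral>x. indicator {0..1} x *\<^sub>R (D x * cnj (D x)) \<partial>lborel) = 
        (\<integral>x. complex_of_real (indicator {0..1} x *\<^sub>R (cmod (D x))\<^sup>2) \<partial>lborel)"
    by (intro Bochner_Integration.integral_cong refl) (simp add: complex_norm_square[symmetric] scaleR_conv_of_real)
  then have "complex_of_real (\<integral>x. indicator {0..1} x *\<^sub>R (cmod (D x))\<^sup>2 \<partial>lborel) = 0"
    unfolding z integral_complex_of_real by simp
  then have z': "(\<integral>x. indicator {0..1} x *\<^sub>R (cmod (D x))\<^sup>2 \<partial>lborel) = 0"
    by (simp only: of_real_eq_0_iff)
  \<comment> \<open>Continuity upgrades a vanishing integral of a nonnegative function to vanishing
    at every point, endpoints included.\<close>
  have c: "continuous_on {0..1} (\<lambda>x. (cmod (D x))\<^sup>2)" using D by (intro continuous_intros)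
  have "set_integrable lborel {0..1} (\<lambda>x. (cmod (D x))\<^sup>2)"
    by (intro borel_integrable_atLeastAtMost' c)
  from set_borel_integral_eq_integral[OF this] z'
  have "((\<lambda>x. (cmod (D x))\<^sup>2) has_integral 0) (cbox 0 1)"
    by (simp add: set_lebesgue_integral_def has_integral_integrable_integral)
  then have "(cmod (D x))\<^sup>2 = 0"
    using c x by (intro has_integral_0_cbox_imp_0[of 0 1 "\<lambda>x. (cmod (D x))\<^sup>2"]) auto
  then show ?thesis by simp
qed

text \<open>Both sides are continuous in x and agree at 0 and 1, so comparing Fourier coefficients
  suffices. On the left the sum over k unfolds to an integral over the line, which is the Gaussian
  transform at \<theta> - n; on the right orthogonality keeps the single term m = n. Both
  coefficients are \<open>G (\<theta> - of_int n)\<close>.\<close>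

lemma gaussian_poisson:
  assumes x: "x \<in> {0..1}"
  shows "(\<integral>k. of_real (G (x + of_int k)) * e (- \<theta> * (x + of_int k)) \<partial>CZ)
       = (\<integral>n. of_real (G (\<theta> - of_int n)) * e (- of_int n * x) \<partial>CZ)"
proof -
  interpret CZ: sigma_finite_measure CZ by (rule sigma_finite_CZ)
  interpret UC: finite_measure UC by (rule finite_measure_UC)
  interpret PC: pair_sigma_finite CZ UC by standard
  define L where "L x = (\<integral>k. of_real (G (x + of_int k)) * e (- \<theta> * (x + of_int k)) \<partial>CZ)" for x
  define R where "R x = (\<integral>n. of_real (G (\<theta> - of_int n)) * e (- of_int n * x) \<partial>CZ)" for x
  have bijm: "bij_betw (\<lambda>n::int. - n) UNIV UNIV" by (rule bij_betwI[where g="\<lambda>n. - n"]) auto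
  have iG: "integrable CZ (\<lambda>n. G (\<theta> - of_int n))"
    using gaussian_sum(1)[of \<theta>] integrable_bij_count_space[OF bijm, of "\<lambda>k. G (\<theta> + of_int k)"] by simp
  have cL: "continuous_on {0..1} L"
    unfolding L_def
    by (rule continuous_on_integral_dominated[OF _ _ _ integrable_int_exp])
      (auto intro!: continuous_intros G_translate_le[simplified] simp: norm_mult)
  have cR: "continuous_on {0..1} R"
    unfolding R_def
    by (rule continuous_on_integral_dominated[OF _ _ _ iG])
      (auto intro!: continuous_intros simp: norm_mult)
  have bij1: "bij_betw (\<lambda>n::int. n + 1) UNIV UNIV" by (rule bij_betwI[where g="\<lambda>n. n - 1"]) auto
  have "L 0 = L 1"
    unfolding L_def
    by (subst integral_bij_count_space[OF bij1, symmetric]) (simp add: add_ac)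
  moreover have "R 0 = R 1"
    unfolding R_def using e_of_int[of "- n" for n] by (simp del: e_of_int)
  moreover have "(\<integral>x. (L x - R x) * e (of_int n * x) \<partial>UC) = 0" for n :: int
  proof -
    define \<phi> where "\<phi> y = of_real (G y) * e (- (\<theta> - of_int n) * y)" for y
    have "L x * e (of_int n * x) = (\<integral>k. \<phi> (x + of_int k) \<partial>CZ)" for x
    proof -
      have "e (- \<theta> * (x + of_int k)) * e (of_int n * x) = e (- (\<theta> - of_int n) * (x + of_int k))" for k
      proof -
        \<comment> \<open>Inserting e(n k) = 1 makes the summand a function of x + k alone, as
          unfolding requires.\<close>
        have "e (of_int n * x) = e (of_int n * x) * e (of_int (n * k))" by (simp only: e_of_int mult_1_right)
        then show ?thesis
          using e_add[of "- \<theta> * (x + of_int k)" "of_int n * x + of_int (n * k)"]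
            e_add[of "of_int n * x" "of_int (n * k)"] by (simp add: algebra_simps del: e_of_int)
      qed
      then have "\<phi> (x + of_int k) = of_real (G (x + of_int k)) * e (- \<theta> * (x + of_int k)) * e (of_int n * x)" for k
        unfolding \<phi>_def by (simp only: mult.assoc)
      then show ?thesis
        unfolding L_def by simp
    qed
    then have "(\<integral>x. L x * e (of_int n * x) \<partial>UC) = (\<integral>x. \<integral>k. \<phi> (x + of_int k) \<partial>CZ \<partial>UC)" by simp
    also have "\<dots> = (\<integral>y. \<phi> y \<partial>lborel)"
      using gaussian_fourier(1) unfolding \<phi>_def
      by (intro integral_periodize(2)[symmetric] integrable_mult_bounded[where B=1] integrable_of_real) auto
    also have "\<dots> = of_real (G (\<theta> - of_int n))"
      unfolding \<phi>_def by (rule gaussian_fourier)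
    finally have Ln: "(\<integral>x. L x * e (of_int n * x) \<partial>UC) = of_real (G (\<theta> - of_int n))" .
    have m: "(\<lambda>(m, x). of_real (G (\<theta> - of_int m)) * e (of_int (n - m) * x)) \<in> borel_measurable (CZ \<Otimes>\<^sub>M UC)"
      by (rule measurable_pair_measure_countable1) (auto intro!: measurable_restrict_space1)
    have i: "integrable (CZ \<Otimes>\<^sub>M UC) (\<lambda>(m, x). of_real (G (\<theta> - of_int m)) * e (of_int (n - m) * x))"
    proof (rule PC.Fubini_integrable[OF m])
      have "measure UC (space UC) = 1" by (simp add: measure_restrict_space space_restrict_space)
      then show "integrable CZ (\<lambda>m. \<integral>x. cmod (case (m, x) of (m, x) \<Rightarrow> of_real (G (\<theta> - of_int m)) * e (of_int (n - m) * x)) \<partial>UC)"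
        using iG by (simp add: norm_mult)
      show "AE m in CZ. integrable UC (\<lambda>x. case (m, x) of (m, x) \<Rightarrow> of_real (G (\<theta> - of_int m)) * e (of_int (n - m) * x))"
        by (auto intro!: UC_continuous continuous_intros)
    qed
    have "R x * e (of_int n * x) = (\<integral>m. of_real (G (\<theta> - of_int m)) * e (of_int (n - m) * x) \<partial>CZ)" for x
    proof -
      have "e (- of_int m * x) * e (of_int n * x) = e (of_int (n - m) * x)" for m
        using e_add[of "- of_int m * x" "of_int n * x"] by (simp add: algebra_simps)
      then have "of_real (G (\<theta> - of_int m)) * e (of_int (n - m) * x) = of_real (G (\<theta> - of_int m)) * e (- of_int m * x) * e (of_int n * x)" for m
        by (simp only: mult.assoc)
      then show ?thesis unfolding R_def by (simp only: integral_mult_left_zero)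
    qed
    then have "(\<integral>x. R x * e (of_int n * x) \<partial>UC) = (\<integral>x. \<integral>m. of_real (G (\<theta> - of_int m)) * e (of_int (n - m) * x) \<partial>CZ \<partial>UC)" by simp
    also have "\<dots> = (\<integral>m. \<integral>x. of_real (G (\<theta> - of_int m)) * e (of_int (n - m) * x) \<partial>UC \<partial>CZ)"
      by (rule PC.Fubini_integral[OF i])
    also have "\<dots> = (\<integral>m. of_real (G (\<theta> - of_int m)) * (if n - m = 0 then 1 else 0) \<partial>CZ)"
      unfolding integral_e[symmetric] by simp
    also have "\<dots> = (\<Sum>m\<in>{n}. of_real (G (\<theta> - of_int m)) * (if n - m = 0 then 1 else 0))"
      by (rule lebesgue_integral_count_space_finite_support[THEN trans]) (auto intro!: sum.cong)
    finally have Rn: "(\<integral>x. R x * e (of_int n * x) \<partial>UC) = of_real (G (\<theta> - of_int n))" by simp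
    have "integrable UC (\<lambda>x. L x * e (of_int n * x))" "integrable UC (\<lambda>x. R x * e (of_int n * x))"
      using cL cR by (auto intro!: UC_continuous continuous_intros)
    then show ?thesis using Ln Rn by (simp add: left_diff_distrib)
  qed
  ultimately have "L x - R x = 0"
    using x cL cR by (intro fourier_uniqueness[of "\<lambda>x. L x - R x"] continuous_intros) auto
  then show ?thesis by (simp add: L_def R_def)
qed

section \<open>The measure as a product with the periodic extension\<close>

text \<open>Most interchanges below have this shape: an integrable outer factor times sections of
  uniformly bounded L1 norm, the bound usually being a Gaussian lattice sum.\<close>

lemma integrable_pair_bounded_section:
  fixes f :: "'a \<Rightarrow> complex" and g :: "'a \<Rightarrow> 'b \<Rightarrow> complex"
  assumes "sigma_finite_measure M1" "sigma_finite_measure M2" and f: "integrable M1 f"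
    and meas: "(\<lambda>(x, y). f x * g x y) \<in> borel_measurable (M1 \<Otimes>\<^sub>M M2)"
    and g: "\<And>x. x \<in> space M1 \<Longrightarrow> integrable M2 (g x)" 
      "\<And>x. x \<in> space M1 \<Longrightarrow> (\<integral>y. cmod (g x y) \<partial>M2) \<le> C"
  shows "integrable (M1 \<Otimes>\<^sub>M M2) (\<lambda>(x, y). f x * g x y)"
proof -
  interpret M1: sigma_finite_measure M1 by fact
  interpret M2: sigma_finite_measure M2 by fact
  interpret P: pair_sigma_finite M1 M2 by standard
  have "(\<lambda>(x, y). cmod (f x * g x y)) \<in> borel_measurable (M1 \<Otimes>\<^sub>M M2)"
    using measurable_compose[OF meas borel_measurable_norm] by (simp add: split_def)
  from M2.borel_measurable_lebesgue_integral[OF this]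
  have m: "(\<lambda>x. cmod (f x) * (\<integral>y. cmod (g x y) \<partial>M2)) \<in> borel_measurable M1"
    by (simp add: norm_mult)
  have "integrable M1 (\<lambda>x. cmod (f x) * (\<integral>y. cmod (g x y) \<partial>M2))"
  proof (rule Bochner_Integration.integrable_bound[OF _ m AE_I2])
    show "integrable M1 (\<lambda>x. cmod (f x) * C)"
      using f by (intro integrable_mult_left integrable_norm)
    fix x assume x: "x \<in> space M1"
    have "\<bar>\<integral>y. cmod (g x y) \<partial>M2\<bar> \<le> \<bar>C\<bar>"
      using g(2)[OF x] by simp
    then show "norm (cmod (f x) * (\<integral>y. cmod (g x y) \<partial>M2)) \<le> norm (cmod (f x) * C)"
      unfolding real_norm_def abs_mult by (rule mult_left_mono) simp
  qed
  then have "integrable M1 (\<lambda>x. \<integral>y. norm (case (x, y) of (x, y) \<Rightarrow> f x * g x y) \<partial>M2)"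
    by (simp add: norm_mult)
  then show ?thesis
  proof (rule P.Fubini_integrable[OF meas])
    show "AE x in M1. integrable M2 (\<lambda>y. case (x, y) of (x, y) \<Rightarrow> f x * g x y)"
      unfolding split by (intro AE_I2 integrable_mult_right g(1))
  qed
qed

lemma borel_measurable_pair_CZ:
  fixes f :: "'a \<Rightarrow> int \<Rightarrow> 'b::topological_space"
  assumes "\<And>k. (\<lambda>x. f x k) \<in> borel_measurable M"
  shows "(\<lambda>(x, k). f x k) \<in> borel_measurable (M \<Otimes>\<^sub>M CZ)"
proof -
  have "(\<lambda>p. f (fst p) (snd p)) \<in> borel_measurable (M \<Otimes>\<^sub>M CZ)"
    by (rule measurable_compose_countable'[where f="\<lambda>k p. f (fst p) k" and g=snd and I=UNIV])
      (auto intro: measurable_compose[OF measurable_fst assms])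
  then show ?thesis by (simp add: split_def)
qed

text \<open>Connects the unordered sum in \<open>delta\<close> with integration over counting
  measure; the inequality suffices because \<open>delta\<close> serves as an upper bound.\<close>

lemma nn_integral_CZ_le_infsum:
  fixes f :: "int \<Rightarrow> ennreal"
  shows "(\<integral>\<^sup>+k. f k \<partial>CZ) \<le> infsum f UNIV"
proof -
  have inf: "infsum f UNIV = (SUP F\<in>{F. finite F \<and> F \<subseteq> UNIV}. sum f F)"
    by (rule nonneg_infsum_complete) simp
  have "(\<integral>\<^sup>+k. f k \<partial>CZ) = (\<integral>\<^sup>+n. f (int_decode n) \<partial>count_space UNIV)"
    by (rule nn_integral_bij_count_space[OF bij_int_decode, symmetric])
  also have "\<dots> = (SUP n. \<Sum>i<n. f (int_decode i))"
    by (simp add: nn_integral_count_space_nat suminf_eq_SUP)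
  also have "\<dots> \<le> infsum f UNIV"
  proof (rule SUP_least)
    fix n
    have "(\<Sum>i<n. f (int_decode i)) = sum f (int_decode ` {..<n})"
      using bij_int_decode by (subst sum.reindex) (auto intro: inj_on_subset simp: bij_def)
    also have "\<dots> \<le> infsum f UNIV" unfolding inf by (rule SUP_upper) simp
    finally show "(\<Sum>i<n. f (int_decode i)) \<le> infsum f UNIV" .
  qed
  finally show ?thesis .
qed

text \<open>\<Lambda> is only Lebesgue measurable, whereas the product measures below are formed
  with \<open>lborel\<close>, so it is replaced by a Borel function. The two must agree at all
  integer translates of a point at once, which excludes only countably many null sets.\<close>

lemma F0_borel_version:
  assumes "\<Lambda> \<in> F0"
  obtains L where "integrable lborel L"
    "AE \<xi> in lborel. \<forall>n::int. L (\<xi> - of_int n) = \<Lambda> (\<xi> - of_int n)"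
    "AE \<xi> in lborel. integrable CZ (\<lambda>n. L (\<xi> - of_int n))"
proof -
  have \<Lambda>: "\<Lambda> \<in> borel_measurable lebesgue" and \<delta>: "delta \<Lambda> < \<infinity>"
    using assms by (auto simp: F0_def S10_R_def L_infty_R_def)
  have "(\<lambda>x. Re (\<Lambda> x)) \<in> borel_measurable lebesgue" "(\<lambda>x. Im (\<Lambda> x)) \<in> borel_measurable lebesgue"
    using \<Lambda> by auto
  from this[THEN completion_ex_borel_measurable_real]
  obtain a b where ab: "a \<in> borel_measurable lborel" "AE x in lborel. Re (\<Lambda> x) = a x"
    "b \<in> borel_measurable lborel" "AE x in lborel. Im (\<Lambda> x) = b x"
    by blast
  define L where "L x = Complex (a x) (b x)" for x
  have [measurable]: "L \<in> borel_measurable borel"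
    using ab(1,3) by (subst borel_measurable_complex_iff) (simp add: L_def)
  have "AE x in lborel. L x = \<Lambda> x"
    using ab(2,4) by eventually_elim (simp add: L_def complex_eq_iff)
  then obtain N where N: "N \<in> sets lborel" "emeasure lborel N = 0" "{x \<in> space lborel. L x \<noteq> \<Lambda> x} \<subseteq> N"
    by (rule AE_E) auto
  have [measurable]: "N \<in> sets borel" using N by simp
  have AEN: "AE x in lborel. x \<notin> N"
    using N by (intro AE_not_in) (auto simp: null_sets_def)
  have AE_shift: "AE \<xi> in lborel. \<forall>n::int. L (\<xi> - of_int n) = \<Lambda> (\<xi> - of_int n)"
  proof (subst AE_all_countable, rule allI)
    fix n :: int
    have "AE \<xi> in lborel. - of_int n + 1 * \<xi> \<notin> N"
      using AEN by (intro AE_borel_affine) auto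
    then show "AE \<xi> in lborel. L (\<xi> - of_int n) = \<Lambda> (\<xi> - of_int n)"
      by eventually_elim (use N(3) in auto)
  qed
  have bij: "bij_betw (\<lambda>n::int. - n) UNIV UNIV" by (rule bij_betwI[where g="\<lambda>n. - n"]) auto
  have "AE \<xi> in lebesgue. (\<Sum>\<^sub>\<infinity>n::int. ennreal (cmod (\<Lambda> (\<xi> + of_int n)))) \<le> delta \<Lambda>"
    unfolding delta_def by (rule esssup_AE)
  then have "AE \<xi> in lborel. (\<Sum>\<^sub>\<infinity>n::int. ennreal (cmod (\<Lambda> (\<xi> + of_int n)))) \<le> delta \<Lambda>"
    by (simp only: AE_completion_iff)
  with AE_shift have bound: "AE \<xi> in lborel. (\<integral>\<^sup>+k. ennreal (cmod (L (\<xi> + of_int k))) \<partial>CZ) \<le> delta \<Lambda>"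
  proof eventually_elim
    case (elim \<xi>)
    have "L (\<xi> + of_int k) = \<Lambda> (\<xi> + of_int k)" for k
      using elim(1)[rule_format, of "- k"] by simp
    then show ?case using order_trans[OF nn_integral_CZ_le_infsum elim(2)] by simp
  qed
  \<comment> \<open>The circle has mass 1, so unfolding bounds the L1 norm of \<open>L\<close> by
    \<open>delta \<Lambda>\<close>.\<close>
  have "AE \<xi> in UC. (\<integral>\<^sup>+k. ennreal (cmod (L (\<xi> + of_int k))) \<partial>CZ) \<le> delta \<Lambda>"
    using bound by (subst AE_restrict_space_iff) (auto elim: eventually_mono)
  then have "(\<integral>\<^sup>+\<xi>. (\<integral>\<^sup>+k. ennreal (cmod (L (\<xi> + of_int k))) \<partial>CZ) \<partial>UC) \<le> (\<integral>\<^sup>+\<xi>. delta \<Lambda> \<partial>UC)"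
    by (rule nn_integral_mono_AE)
  also have "\<dots> < \<infinity>"
    using \<delta> by (simp add: emeasure_restrict_space space_restrict_space)
  finally have "integrable lborel L"
    by (intro integrableI_bounded) (auto simp: nn_integral_periodize)
  moreover have "AE \<xi> in lborel. integrable CZ (\<lambda>n. L (\<xi> - of_int n))"
    using bound
  proof eventually_elim
    case (elim \<xi>)
    then have "integrable CZ (\<lambda>k. L (\<xi> + of_int k))"
      using \<delta> by (intro integrableI_bounded) (auto simp: le_less_trans)
    then show ?case
      using integrable_bij_count_space[OF bij, of "\<lambda>k. L (\<xi> + of_int k)"] by simp
  qed
  ultimately show ?thesis using that AE_shift by blast
qed

lemma W_eq_integral:
  assumes "integrable CZ (\<lambda>n. \<phi> n * \<Lambda> (\<xi> - of_int n))"
  shows "W \<phi> \<Lambda> \<xi> = (\<integral>n. \<phi> n * \<Lambda> (\<xi> - of_int n) \<partial>CZ)"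
  using infsetsum_infsum[of "\<lambda>n. \<phi> n * \<Lambda> (\<xi> - of_int n)" UNIV] assms
  by (simp add: W_def infsetsum_def Infinite_Set_Sum.abs_summable_on_def)

section \<open>The Gaussian-weighted product formula\<close>

text \<open>Both sides are transforms at an arbitrary \<xi>: of \<open>G\<close> times \<mu>, and of
  \<open>G\<close> h times the periodic extension of \<nu>, encoded on pairs (x, k). The frequency
  sum over n in the hypothesis becomes the spatial sum over k through Poisson summation, applied
  separately for each x and each \<eta>.\<close>

lemma twisted_Fourier_identity:
  fixes L u v :: "real \<Rightarrow> complex" and N M :: "real measure"
  assumes L: "integrable lborel L"
    and N: "finite_measure N" "sets N = sets borel_circle" and u: "integrable N u"
    and M: "finite_measure M" "sets M = sets borel" and v: "integrable M v"
    and AE: "AE \<xi> in lborel. (\<integral>x. e (- \<xi> * x) * v x \<partial>M)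
       = (\<integral>n. (\<integral>x. e (- of_int n * x) * u x \<partial>N) * L (\<xi> - of_int n) \<partial>CZ)"
  defines "h \<equiv> \<lambda>x. \<integral>\<eta>. L \<eta> * e (\<eta> * x) \<partial>lborel"
  shows "integrable (N \<Otimes>\<^sub>M CZ) (\<lambda>(x, k). u x * (of_real (G (x + of_int k)) * h (x + of_int k)))"
    "(\<integral>x. (v x * of_real (G x)) * e (- \<xi> * x) \<partial>M) =
     (\<integral>(x, k). (u x * (of_real (G (x + of_int k)) * h (x + of_int k))) * e (- \<xi> * (x + of_int k)) \<partial>(N \<Otimes>\<^sub>M CZ))"
proof -
  interpret CZ: sigma_finite_measure CZ by (rule sigma_finite_CZ)
  interpret N: finite_measure N by fact
  interpret M: finite_measure M by fact
  interpret MQ: pair_sigma_finite M lborel by standard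
  interpret LC: pair_sigma_finite lborel CZ by standard
  interpret NC: pair_sigma_finite N CZ by standard
  note [measurable_cong] = M(2)
  have [measurable]: "L \<in> borel_measurable borel" using L by simp
  have [measurable]: "v \<in> borel_measurable M" using v by auto
  have mu: "u \<in> borel_measurable N" using u by auto
  have onN: "f \<in> borel_measurable borel \<Longrightarrow> f \<in> borel_measurable N" for f :: "real \<Rightarrow> complex"
    using N(2) by (simp add: measurable_restrict_space1 cong: measurable_cong_sets)
  have spN: "x \<in> {0..1}" if "x \<in> space N" for x
    using that sets_eq_imp_space_eq[OF N(2)] by (auto simp: space_restrict_space)
  have [measurable]: "h \<in> borel_measurable borel"
    unfolding h_def by measurable
  define C where "C = (\<integral>k. exp (3 - 2 * \<bar>real_of_int k\<bar>) \<partial>CZ)"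
  have hB: "cmod (h x) \<le> (\<integral>\<eta>. cmod (L \<eta>) \<partial>lborel)" for x
    unfolding h_def by (rule order_trans[OF integral_norm_bound]) (simp add: norm_mult)
  have bijm: "bij_betw (\<lambda>n::int. - n) UNIV UNIV" by (rule bij_betwI[where g="\<lambda>n. - n"]) auto
  have Gm: "integrable CZ (\<lambda>n. G (\<theta> - of_int n))" "(\<integral>n. G (\<theta> - of_int n) \<partial>CZ) \<le> C" for \<theta>
    using gaussian_sum[of \<theta>] integrable_bij_count_space[OF bijm, of "\<lambda>k. G (\<theta> + of_int k)"]
      integral_bij_count_space[OF bijm, of "\<lambda>k. G (\<theta> + of_int k)"] by (simp_all add: C_def)
  define B where "B = (\<integral>\<eta>. cmod (L \<eta>) \<partial>lborel)"
  \<comment> \<open>The bounded factor \<open>w\<close> covers two uses: constant 1 for the first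
    claim, and the character at x + k for the last interchange.\<close>
  have iNC: "integrable (N \<Otimes>\<^sub>M CZ) (\<lambda>(x, k). u x * (of_real (G (x + of_int k)) * h (x + of_int k) * w x k))"
    if w: "\<And>x k. cmod (w x k) \<le> 1" and mw: "\<And>k. (\<lambda>x. w x k) \<in> borel_measurable N" for w
  proof (rule integrable_pair_bounded_section[where C="C * B"])
    show "(\<lambda>(x, k). u x * (of_real (G (x + of_int k)) * h (x + of_int k) * w x k)) \<in> borel_measurable (N \<Otimes>\<^sub>M CZ)"
      by (rule borel_measurable_pair_CZ, rule borel_measurable_times[OF mu borel_measurable_times[OF onN mw]])
        measurable
    fix x
    have le: "cmod (of_real (G (x + of_int k)) * h (x + of_int k) * w x k) \<le> G (x + of_int k) * B" for k
    proof -
      have "cmod (h (x + of_int k)) * cmod (w x k) \<le> B * 1"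
        using hB[of "x + of_int k"] w[of x k] order_trans[OF norm_ge_zero hB]
        unfolding B_def by (intro mult_mono) auto
      then show ?thesis by (simp add: norm_mult mult.assoc)
    qed
    show i: "integrable CZ (\<lambda>k. of_real (G (x + of_int k)) * h (x + of_int k) * w x k)"
    proof (rule Bochner_Integration.integrable_bound[OF integrable_mult_left[OF gaussian_sum(1)[of x], of B]])
      show "AE k in CZ. cmod (of_real (G (x + of_int k)) * h (x + of_int k) * w x k) \<le> norm (G (x + of_int k) * B)"
        unfolding real_norm_def by (intro AE_I2 order_trans[OF le abs_ge_self])
    qed simp
    have "(\<integral>k. cmod (of_real (G (x + of_int k)) * h (x + of_int k) * w x k) \<partial>CZ) \<le> (\<integral>k. G (x + of_int k) * B \<partial>CZ)"
      by (rule integral_mono[OF integrable_norm[OF i] integrable_mult_left[OF gaussian_sum(1)] le])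
    also have "\<dots> = (\<integral>k. G (x + of_int k) \<partial>CZ) * B"
      by (rule integral_mult_left_zero)
    also have "\<dots> \<le> C * B"
      using gaussian_sum(2)[of x] order_trans[OF norm_ge_zero hB]
      unfolding C_def B_def by (rule mult_right_mono)
    finally show "(\<integral>k. cmod (of_real (G (x + of_int k)) * h (x + of_int k) * w x k) \<partial>CZ) \<le> C * B" .
  qed (use u N.sigma_finite_measure_axioms CZ.sigma_finite_measure_axioms in auto)
  from iNC[of "\<lambda>_ _. 1"]
  show "integrable (N \<Otimes>\<^sub>M CZ) (\<lambda>(x, k). u x * (of_real (G (x + of_int k)) * h (x + of_int k)))"
    by simp

  define F where "F \<zeta> = (\<integral>x. e (- \<zeta> * x) * v x \<partial>M)" for \<zeta>
  define \<phi> where "\<phi> n = (\<integral>x. e (- of_int n * x) * u x \<partial>N)" for n :: int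
  have \<phi>B: "cmod (\<phi> n) \<le> (\<integral>x. cmod (u x) \<partial>N)" for n
    unfolding \<phi>_def by (rule order_trans[OF integral_norm_bound]) (simp add: norm_mult)
  have [measurable]: "F \<in> borel_measurable borel"
    unfolding F_def by measurable
  have Wm[measurable]: "(\<lambda>\<zeta>. \<integral>n. \<phi> n * L (\<zeta> - of_int n) \<partial>CZ) \<in> borel_measurable borel"
  proof (rule CZ.borel_measurable_lebesgue_integral)
    show "(\<lambda>(\<zeta>, n). \<phi> n * L (\<zeta> - of_int n)) \<in> borel_measurable (borel \<Otimes>\<^sub>M CZ)"
      by (rule borel_measurable_pair_CZ) measurable
  qed
  \<comment> \<open>Null sets are translation invariant, so for any fixed \<xi> the hypothesis holds
    at \<xi> + \<eta> for almost every \<eta>.\<close>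
  have AE': "AE \<eta> in lborel. F (\<xi> + 1 * \<eta>) = (\<integral>n. \<phi> n * L (\<xi> + 1 * \<eta> - of_int n) \<partial>CZ)"
    using AE unfolding F_def[symmetric] \<phi>_def[symmetric]
    by (rule AE_borel_affine[where P="\<lambda>\<zeta>. F \<zeta> = (\<integral>n. \<phi> n * L (\<zeta> - of_int n) \<partial>CZ)", rotated 2]) simp_all

  have iQ: "integrable (lborel \<Otimes>\<^sub>M CZ) (\<lambda>(\<eta>, n). L \<eta> * (of_real (G (\<xi> - \<eta> - of_int n)) * w n))"
    if w: "\<And>n. cmod (w n) \<le> 1" for w
  proof (rule integrable_pair_bounded_section[where C=C])
    fix \<eta>
    have le: "cmod (of_real (G (\<xi> - \<eta> - of_int n)) * w n) \<le> G (\<xi> - \<eta> - of_int n)" for n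
      using mult_left_mono[OF w, of "G (\<xi> - \<eta> - of_int n)"] by (simp add: norm_mult)
    show i: "integrable CZ (\<lambda>n. of_real (G (\<xi> - \<eta> - of_int n)) * w n)"
    proof (rule Bochner_Integration.integrable_bound[OF Gm(1)[of "\<xi> - \<eta>"]])
      show "AE n in CZ. cmod (of_real (G (\<xi> - \<eta> - of_int n)) * w n) \<le> norm (G (\<xi> - \<eta> - of_int n))"
        unfolding real_norm_def by (intro AE_I2 order_trans[OF le abs_ge_self])
    qed simp
    have "(\<integral>n. cmod (of_real (G (\<xi> - \<eta> - of_int n)) * w n) \<partial>CZ) \<le> (\<integral>n. G (\<xi> - \<eta> - of_int n) \<partial>CZ)"
      by (rule integral_mono[OF integrable_norm[OF i] Gm(1) le])
    also have "\<dots> \<le> C" by (rule Gm)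
    finally show "(\<integral>n. cmod (of_real (G (\<xi> - \<eta> - of_int n)) * w n) \<partial>CZ) \<le> C" .
    show "(\<lambda>(\<eta>, n). L \<eta> * (of_real (G (\<xi> - \<eta> - of_int n)) * w n)) \<in> borel_measurable (lborel \<Otimes>\<^sub>M CZ)"
      by (rule borel_measurable_pair_CZ) measurable
  qed (use L CZ.sigma_finite_measure_axioms sigma_finite_lborel in auto)
  \<comment> \<open>\<open>c n\<close> is the convolution of \<open>L\<close> with \<open>G\<close>,
    evaluated at \<xi> - n.\<close>
  define c where "c n = (\<integral>\<eta>. L \<eta> * of_real (G (\<xi> - \<eta> - of_int n)) \<partial>lborel)" for n :: int
  have iQ1: "integrable (lborel \<Otimes>\<^sub>M CZ) (\<lambda>(\<eta>, n). L \<eta> * of_real (G (\<xi> - \<eta> - of_int n)))"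
    using iQ[of "\<lambda>_. 1"] by simp
  have ic: "integrable CZ c"
    unfolding c_def by (rule LC.integrable_snd[OF iQ1])

  \<comment> \<open>Writing \<open>G x\<close> as the transform of \<open>G\<close> turns the weight
    in space into an average of \<open>F\<close> over frequencies \<xi> + \<eta>.\<close>
  have Mxi: "(\<integral>x. (v x * of_real (G x)) * e (- \<xi> * x) \<partial>M) = (\<integral>\<eta>. of_real (G \<eta>) * F (\<xi> + \<eta>) \<partial>lborel)"
  proof -
    have i: "integrable (M \<Otimes>\<^sub>M lborel) (\<lambda>(x, \<eta>). v x * (of_real (G \<eta>) * e (- (\<xi> + \<eta>) * x)))"
    proof (rule integrable_pair_bounded_section[where C="\<integral>\<eta>. G \<eta> \<partial>lborel"])
      show "integrable lborel (\<lambda>\<eta>. of_real (G \<eta>) * e (- (\<xi> + \<eta>) * x))" for x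
        using gaussian_fourier(1) by (intro integrable_mult_bounded[where B=1] integrable_of_real) auto
    qed (use v M.sigma_finite_measure_axioms sigma_finite_lborel in \<open>auto simp: norm_mult\<close>)
    have "(v x * of_real (G x)) * e (- \<xi> * x) = (\<integral>\<eta>. v x * (of_real (G \<eta>) * e (- (\<xi> + \<eta>) * x)) \<partial>lborel)" for x
    proof -
      have "e (- (\<xi> + \<eta>) * x) = e (- x * \<eta>) * e (- \<xi> * x)" for \<eta>
        using e_add[of "- x * \<eta>" "- \<xi> * x"] by (simp add: algebra_simps)
      then have "(\<integral>\<eta>. v x * (of_real (G \<eta>) * e (- (\<xi> + \<eta>) * x)) \<partial>lborel)
         = (\<integral>\<eta>. v x * ((of_real (G \<eta>) * e (- x * \<eta>)) * e (- \<xi> * x)) \<partial>lborel)"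
        by (simp only: mult.assoc)
      also have "\<dots> = v x * (of_real (G x) * e (- \<xi> * x))"
        by (simp only: integral_mult_right_zero integral_mult_left_zero gaussian_fourier(2))
      finally show ?thesis by (simp only: mult.assoc)
    qed
    then have "(\<integral>x. (v x * of_real (G x)) * e (- \<xi> * x) \<partial>M) =
      (\<integral>x. \<integral>\<eta>. v x * (of_real (G \<eta>) * e (- (\<xi> + \<eta>) * x)) \<partial>lborel \<partial>M)"
      by (rule Bochner_Integration.integral_cong[OF refl])
    also have "\<dots> = (\<integral>\<eta>. \<integral>x. v x * (of_real (G \<eta>) * e (- (\<xi> + \<eta>) * x)) \<partial>M \<partial>lborel)"
      by (rule MQ.Fubini_integral[OF i, symmetric])
    also have "\<dots> = (\<integral>\<eta>. \<integral>x. of_real (G \<eta>) * (e (- (\<xi> + \<eta>) * x) * v x) \<partial>M \<partial>lborel)"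
      by (simp only: mult_ac)
    also have "\<dots> = (\<integral>\<eta>. of_real (G \<eta>) * F (\<xi> + \<eta>) \<partial>lborel)"
      unfolding F_def by (simp only: integral_mult_right_zero)
    finally show ?thesis .
  qed
  \<comment> \<open>Under the integral over \<eta> the exceptional null set of the hypothesis
    disappears.\<close>
  also have "\<dots> = (\<integral>\<eta>. \<integral>n. \<phi> n * (of_real (G \<eta>) * L (\<xi> + \<eta> - of_int n)) \<partial>CZ \<partial>lborel)"
  proof (rule integral_cong_AE)
    show "AE \<eta> in lborel. of_real (G \<eta>) * F (\<xi> + \<eta>) = (\<integral>n. \<phi> n * (of_real (G \<eta>) * L (\<xi> + \<eta> - of_int n)) \<partial>CZ)"
      using AE'
    proof eventually_elim
      case (elim \<eta>)
      have "(\<integral>n. \<phi> n * (of_real (G \<eta>) * L (\<xi> + \<eta> - of_int n)) \<partial>CZ) = (\<integral>n. of_real (G \<eta>) * (\<phi> n * L (\<xi> + \<eta> - of_int n)) \<partial>CZ)"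
        by (simp only: mult_ac)
      then show ?case using elim by (simp only: integral_mult_right_zero mult_1)
    qed
    show "(\<lambda>\<eta>. \<integral>n. \<phi> n * (of_real (G \<eta>) * L (\<xi> + \<eta> - of_int n)) \<partial>CZ) \<in> borel_measurable lborel"
    proof (rule CZ.borel_measurable_lebesgue_integral)
      show "(\<lambda>(\<eta>, n). \<phi> n * (of_real (G \<eta>) * L (\<xi> + \<eta> - of_int n))) \<in> borel_measurable (lborel \<Otimes>\<^sub>M CZ)"
        by (rule borel_measurable_pair_CZ) measurable
    qed
  qed measurable
  also have "\<dots> = (\<integral>n. \<integral>\<eta>. \<phi> n * (of_real (G \<eta>) * L (\<xi> + \<eta> - of_int n)) \<partial>lborel \<partial>CZ)"
  proof -
    interpret CL: pair_sigma_finite CZ lborel by standard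
    have m: "(\<lambda>(n, \<eta>). \<phi> n * (of_real (G \<eta>) * L (\<xi> + \<eta> - of_int n))) \<in> borel_measurable (CZ \<Otimes>\<^sub>M lborel)"
      by (rule measurable_pair_measure_countable1) simp_all
    \<comment> \<open>Substitution identifies the L1 norms in \<eta> with those from
      \<open>iQ1\<close>, which are summable in n; together with the bound on \<phi> this justifies
      the interchange.\<close>
    have sh: "(\<integral>\<eta>. cmod (L \<eta>) * G (\<xi> - \<eta> - of_int n) \<partial>lborel) = (\<integral>\<eta>. G \<eta> * cmod (L (\<xi> + \<eta> - of_int n)) \<partial>lborel)" for n
      by (subst lborel_integral_real_affine[where c=1 and t="\<xi> - of_int n"]) (simp_all add: algebra_simps)
    have "integrable CZ (\<lambda>n. \<integral>\<eta>. cmod (case (\<eta>, n) of (\<eta>, n) \<Rightarrow> L \<eta> * of_real (G (\<xi> - \<eta> - of_int n))) \<partial>lborel)"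
      using integrable_norm[OF iQ1] by (intro LC.integrable_snd) (simp add: split_def)
    then have d: "integrable CZ (\<lambda>n. \<integral>\<eta>. G \<eta> * cmod (L (\<xi> + \<eta> - of_int n)) \<partial>lborel)"
      unfolding sh[symmetric] by (simp add: norm_mult)
    have "integrable (CZ \<Otimes>\<^sub>M lborel) (\<lambda>(n, \<eta>). \<phi> n * (of_real (G \<eta>) * L (\<xi> + \<eta> - of_int n)))"
    proof (rule CL.Fubini_integrable[OF m])
      have nn: "0 \<le> (\<integral>\<eta>. G \<eta> * cmod (L (\<xi> + \<eta> - of_int n)) \<partial>lborel)" for n by simp
      show "integrable CZ (\<lambda>n. \<integral>\<eta>. norm (case (n, \<eta>) of (n, \<eta>) \<Rightarrow> \<phi> n * (of_real (G \<eta>) * L (\<xi> + \<eta> - of_int n))) \<partial>lborel)"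
        using \<phi>B nn order_trans[OF norm_ge_zero \<phi>B]
        by (intro Bochner_Integration.integrable_bound[OF integrable_mult_right[OF d, of "\<integral>x. cmod (u x) \<partial>N"]])
          (auto simp: norm_mult abs_mult intro!: mult_right_mono)
      show "AE n in CZ. integrable lborel (\<lambda>\<eta>. case (n, \<eta>) of (n, \<eta>) \<Rightarrow> \<phi> n * (of_real (G \<eta>) * L (\<xi> + \<eta> - of_int n)))"
      proof (rule AE_I2)
        fix n
        have "integrable lborel (\<lambda>\<eta>. L ((\<xi> - of_int n) + 1 * \<eta>) * of_real (G \<eta>))"
          using L by (intro integrable_mult_bounded[where B=1] lborel_integrable_real_affine) auto
        then have "integrable lborel (\<lambda>\<eta>. \<phi> n * (L ((\<xi> - of_int n) + 1 * \<eta>) * of_real (G \<eta>)))"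
          by (rule integrable_mult_right)
        moreover have "(\<xi> - of_int n) + 1 * \<eta> = \<xi> + \<eta> - of_int n" for \<eta> by simp
        ultimately show "integrable lborel (\<lambda>\<eta>. case (n, \<eta>) of (n, \<eta>) \<Rightarrow> \<phi> n * (of_real (G \<eta>) * L (\<xi> + \<eta> - of_int n)))"
          by (simp only: split mult_ac)
      qed
    qed
    from CL.Fubini_integral[OF this] show ?thesis .
  qed
  also have "\<dots> = (\<integral>n. \<phi> n * c n \<partial>CZ)"
  proof -
    have "c n = (\<integral>\<eta>. of_real (G \<eta>) * L (\<xi> + \<eta> - of_int n) \<partial>lborel)" for n
      unfolding c_def
      by (subst lborel_integral_real_affine[where c=1 and t="\<xi> - of_int n"]) (simp_all add: algebra_simps)
    then show ?thesis by (simp only: integral_mult_right_zero)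
  qed
  also have "\<dots> = (\<integral>n. \<integral>x. u x * (c n * e (- of_int n * x)) \<partial>N \<partial>CZ)"
  proof -
    have "(\<integral>x. u x * (c n * e (- of_int n * x)) \<partial>N) = (\<integral>x. (e (- of_int n * x) * u x) * c n \<partial>N)" for n
      by (simp only: mult_ac)
    then show ?thesis unfolding \<phi>_def by (simp only: integral_mult_left_zero)
  qed
  also have "\<dots> = (\<integral>x. \<integral>n. u x * (c n * e (- of_int n * x)) \<partial>CZ \<partial>N)"
  proof (rule NC.Fubini_integral, rule integrable_pair_bounded_section[where C="\<integral>n. cmod (c n) \<partial>CZ"])
    show "integrable CZ (\<lambda>n. c n * e (- of_int n * x))" for x
      using ic by (rule integrable_mult_bounded[where B=1]) auto
    show "(\<lambda>(x, n). u x * (c n * e (- of_int n * x))) \<in> borel_measurable (N \<Otimes>\<^sub>M CZ)"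
      by (rule borel_measurable_pair_CZ, rule borel_measurable_times[OF mu onN]) measurable
  qed (use u N.sigma_finite_measure_axioms CZ.sigma_finite_measure_axioms in \<open>auto simp: norm_mult\<close>)
  also have "\<dots> = (\<integral>x. \<integral>k. u x * (of_real (G (x + of_int k)) * h (x + of_int k) * e (- \<xi> * (x + of_int k))) \<partial>CZ \<partial>N)"
  proof (rule Bochner_Integration.integral_cong[OF refl])
    fix x assume "x \<in> space N"
    then have x: "x \<in> {0..1}" by (rule spN)
    have iK: "integrable (lborel \<Otimes>\<^sub>M CZ) (\<lambda>(\<eta>, k). L \<eta> * (of_real (G (x + of_int k)) * e (- (\<xi> - \<eta>) * (x + of_int k))))"
    proof (rule integrable_pair_bounded_section[where C=C])
      show "(\<lambda>(\<eta>, k). L \<eta> * (of_real (G (x + of_int k)) * e (- (\<xi> - \<eta>) * (x + of_int k)))) \<in> borel_measurable (lborel \<Otimes>\<^sub>M CZ)"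
        by (rule borel_measurable_pair_CZ) measurable
      show "integrable CZ (\<lambda>k. of_real (G (x + of_int k)) * e (- (\<xi> - \<eta>) * (x + of_int k)))" for \<eta>
        using gaussian_sum(1)[of x] by (intro integrable_mult_bounded[where B=1] integrable_of_real) auto
      show "(\<integral>k. cmod (of_real (G (x + of_int k)) * e (- (\<xi> - \<eta>) * (x + of_int k))) \<partial>CZ) \<le> C" for \<eta>
        using gaussian_sum(2)[of x] by (simp add: norm_mult C_def)
    qed (use L CZ.sigma_finite_measure_axioms sigma_finite_lborel in auto)
    have "(\<integral>n. c n * e (- of_int n * x) \<partial>CZ) = 
      (\<integral>n. \<integral>\<eta>. L \<eta> * (of_real (G (\<xi> - \<eta> - of_int n)) * e (- of_int n * x)) \<partial>lborel \<partial>CZ)"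
      unfolding c_def integral_mult_left_zero[symmetric] by (simp only: mult.assoc)
    also have "\<dots> = (\<integral>\<eta>. \<integral>n. L \<eta> * (of_real (G (\<xi> - \<eta> - of_int n)) * e (- of_int n * x)) \<partial>CZ \<partial>lborel)"
      by (rule LC.Fubini_integral, rule iQ) simp
    \<comment> \<open>Poisson summation at \<theta> = \<xi> - \<eta>; x lies in [0,1] because
      \<open>N\<close> lives on the circle. Integrating over \<eta> first afterwards rebuilds h at x
      + k.\<close>
    also have "\<dots> = (\<integral>\<eta>. \<integral>k. L \<eta> * (of_real (G (x + of_int k)) * e (- (\<xi> - \<eta>) * (x + of_int k))) \<partial>CZ \<partial>lborel)"
      by (simp only: integral_mult_right_zero gaussian_poisson[OF x])
    also have "\<dots> = (\<integral>k. \<integral>\<eta>. L \<eta> * (of_real (G (x + of_int k)) * e (- (\<xi> - \<eta>) * (x + of_int k))) \<partial>lborel \<partial>CZ)"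
      by (rule LC.Fubini_integral[OF iK, symmetric])
    also have "\<dots> = (\<integral>k. of_real (G (x + of_int k)) * h (x + of_int k) * e (- \<xi> * (x + of_int k)) \<partial>CZ)"
    proof (rule Bochner_Integration.integral_cong[OF refl])
      fix k
      have "L \<eta> * (of_real (G (x + of_int k)) * e (- (\<xi> - \<eta>) * (x + of_int k))) =
        (of_real (G (x + of_int k)) * e (- \<xi> * (x + of_int k))) * (L \<eta> * e (\<eta> * (x + of_int k)))" for \<eta>
        using e_add[of "- \<xi> * (x + of_int k)" "\<eta> * (x + of_int k)"] by (simp add: algebra_simps)
      then have "(\<integral>\<eta>. L \<eta> * (of_real (G (x + of_int k)) * e (- (\<xi> - \<eta>) * (x + of_int k))) \<partial>lborel) =
        (of_real (G (x + of_int k)) * e (- \<xi> * (x + of_int k))) * h (x + of_int k)"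
        unfolding h_def integral_mult_right_zero[symmetric]
        by (rule Bochner_Integration.integral_cong[OF refl])
      then show "(\<integral>\<eta>. L \<eta> * (of_real (G (x + of_int k)) * e (- (\<xi> - \<eta>) * (x + of_int k))) \<partial>lborel) =
        of_real (G (x + of_int k)) * h (x + of_int k) * e (- \<xi> * (x + of_int k))"
        by (simp only: mult_ac)
    qed
    finally show "(\<integral>n. u x * (c n * e (- of_int n * x)) \<partial>CZ) =
      (\<integral>k. u x * (of_real (G (x + of_int k)) * h (x + of_int k) * e (- \<xi> * (x + of_int k))) \<partial>CZ)"
      by (simp only: integral_mult_right_zero)
  qed
  also have "\<dots> = (\<integral>(x, k). u x * (of_real (G (x + of_int k)) * h (x + of_int k) * e (- \<xi> * (x + of_int k))) \<partial>(N \<Otimes>\<^sub>M CZ))"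
    by (rule NC.integral_fst, rule iNC, simp, rule onN) measurable
  finally show "(\<integral>x. (v x * of_real (G x)) * e (- \<xi> * x) \<partial>M) =
     (\<integral>(x, k). (u x * (of_real (G (x + of_int k)) * h (x + of_int k))) * e (- \<xi> * (x + of_int k)) \<partial>(N \<Otimes>\<^sub>M CZ))"
    by (simp only: mult.assoc)
qed

text \<open>The complex density on pairs (x, k), pushed forward along x + k, is the weighted
  periodic extension. Its transform agrees with that of \<open>G\<close> times \<mu> at every
  frequency, so the two measures agree on every Borel set.\<close>

lemma translated_product_formula:
  fixes L u v :: "real \<Rightarrow> complex" and N M :: "real measure"
  assumes L: "integrable lborel L"
    and N: "finite_measure N" "sets N = sets borel_circle" and u: "integrable N u"
    and M: "finite_measure M" "sets M = sets borel" and v: "integrable M v"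
    and AE: "AE \<xi> in lborel. (\<integral>x. e (- \<xi> * x) * v x \<partial>M)
       = (\<integral>n. (\<integral>x. e (- of_int n * x) * u x \<partial>N) * L (\<xi> - of_int n) \<partial>CZ)"
    and A: "A \<in> sets borel"
  defines "h \<equiv> \<lambda>x. \<integral>\<eta>. L \<eta> * e (\<eta> * x) \<partial>lborel"
  shows "(\<integral>x. (v x * of_real (G x)) * indicator A x \<partial>M) =
     (\<integral>x. \<integral>k. (u x * (of_real (G (x + of_int k)) * h (x + of_int k))) * indicator A (x + of_int k) \<partial>CZ \<partial>N)"
proof -
  interpret CZ: sigma_finite_measure CZ by (rule sigma_finite_CZ)
  interpret N: finite_measure N by fact
  interpret NC: pair_sigma_finite N CZ by standard
  note [measurable_cong] = M(2)
  have onN: "f \<in> borel_measurable borel \<Longrightarrow> f \<in> borel_measurable N" for f :: "real \<Rightarrow> real"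
    using N(2) by (simp add: measurable_restrict_space1 cong: measurable_cong_sets)
  define F' where "F' = (\<lambda>(x, k::int). u x * (of_real (G (x + of_int k)) * h (x + of_int k)))"
  define X' where "X' = (\<lambda>(x, k::int). x + real_of_int k)"
  have F': "integrable (N \<Otimes>\<^sub>M CZ) F'"
    unfolding F'_def h_def by (rule twisted_Fourier_identity(1)[OF L N u M v AE])
  have X': "X' \<in> borel_measurable (N \<Otimes>\<^sub>M CZ)"
    unfolding X'_def by (rule borel_measurable_pair_CZ, rule onN) measurable
  have F: "integrable M (\<lambda>x. v x * of_real (G x))"
    using v by (intro integrable_mult_bounded[where B=1]) auto
  have "(\<integral>x. (v x * of_real (G x)) * indicator A x \<partial>M) = (\<integral>p. F' p * indicator A (X' p) \<partial>(N \<Otimes>\<^sub>M CZ))"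
  proof (rule pushforward_unique[OF F _ F' X' _ A])
    fix t :: real
    \<comment> \<open>The substitution \<xi> = -t / (2 \<pi>) passes between the convention of
      \<open>char\<close> and that of \<open>e\<close>.\<close>
    have eq: "iexp (t * y) = e (- (- t / (2 * pi)) * y)" for y
    proof -
      have "2 * pi * (- (- t / (2 * pi)) * y) = t * y" by simp
      then show ?thesis by (simp only: cis_conv_exp)
    qed
    have "(\<integral>x. (v x * of_real (G x)) * e (- (- t / (2 * pi)) * x) \<partial>M) = 
      (\<integral>(x, k). (u x * (of_real (G (x + of_int k)) * h (x + of_int k))) * e (- (- t / (2 * pi)) * (x + of_int k)) \<partial>(N \<Otimes>\<^sub>M CZ))"
      unfolding h_def by (rule twisted_Fourier_identity(2)[OF L N u M v AE])
    then show "(\<integral>x. (v x * of_real (G x)) * iexp (t * x) \<partial>M) = (\<integral>p. F' p * iexp (t * X' p) \<partial>(N \<Otimes>\<^sub>M CZ))"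
      unfolding eq F'_def X'_def by (simp only: split_def)
  qed measurable
  also have "\<dots> = (\<integral>(x, k). F' (x, k) * indicator A (X' (x, k)) \<partial>(N \<Otimes>\<^sub>M CZ))"
    by (simp add: split_def)
  also have "\<dots> = (\<integral>x. \<integral>k. F' (x, k) * indicator A (X' (x, k)) \<partial>CZ \<partial>N)"
  proof (rule NC.integral_fst[symmetric])
    have "(\<lambda>p. indicator A (X' p) :: complex) \<in> borel_measurable (N \<Otimes>\<^sub>M CZ)"
      using A by (intro measurable_compose[OF X'] borel_measurable_indicator)
    then have "integrable (N \<Otimes>\<^sub>M CZ) (\<lambda>p. F' p * indicator A (X' p))"
      by (rule integrable_mult_bounded[OF F', where B=1]) (simp add: indicator_def)
    then show "integrable (N \<Otimes>\<^sub>M CZ) (\<lambda>(x, k). F' (x, k) * indicator A (X' (x, k)))"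
      by (simp add: split_def)
  qed
  finally show ?thesis by (simp add: F'_def X'_def)
qed

section \<open>Transfer of vanishing sets and the two conclusions\<close>

text \<open>Tested on \<open>A \<inter> B\<close> for arbitrary Borel B, each term of the product
  formula contains \<open>u x\<close> with x + k in A and is therefore 0, whatever h is. Hence
  \<open>v\<close> times \<open>G\<close> vanishes a.e. on A, and \<open>G\<close> is
  positive.\<close>

lemma density_vanishes_on:
  fixes L u v :: "real \<Rightarrow> complex" and N M :: "real measure"
  assumes L: "integrable lborel L"
    and N: "finite_measure N" "sets N = sets borel_circle" and u: "integrable N u"
    and M: "finite_measure M" "sets M = sets borel" and v: "integrable M v"
    and AE: "AE \<xi> in lborel. (\<integral>x. e (- \<xi> * x) * v x \<partial>M)
       = (\<integral>n. (\<integral>x. e (- of_int n * x) * u x \<partial>N) * L (\<xi> - of_int n) \<partial>CZ)"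
    and A[measurable]: "A \<in> sets borel"
    and zero: "\<And>k::int. AE x in N. x + of_int k \<in> A \<longrightarrow> u x = 0"
  shows "AE x in M. x \<in> A \<longrightarrow> v x = 0"
proof -
  interpret M: finite_measure M by fact
  note [measurable_cong] = M(2)
  have [measurable]: "v \<in> borel_measurable M" using v by auto
  have i: "integrable M (\<lambda>x. (v x * of_real (G x)) * indicator A x)"
    using v by (intro integrable_mult_bounded[where B=1]) (auto simp: indicator_def)
  have "AE x in M. (v x * of_real (G x)) * indicator A x = 0"
  proof (rule M.density_zero[OF i])
    fix B assume "B \<in> sets M"
    then have B: "A \<inter> B \<in> sets borel" using M by simp
    have "set_lebesgue_integral M B (\<lambda>x. (v x * of_real (G x)) * indicator A x)
      = (\<integral>x. (v x * of_real (G x)) * indicator (A \<inter> B) x \<partial>M)"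
      unfolding set_lebesgue_integral_def
      by (intro Bochner_Integration.integral_cong refl) (auto simp: indicator_def)
    also have "\<dots> = 0"
      unfolding translated_product_formula[OF L N u M v AE B]
    proof (rule integral_eq_zero_AE)
      have "AE x in N. \<forall>k::int. x + of_int k \<in> A \<longrightarrow> u x = 0"
        using zero by (subst AE_all_countable) blast
      then show "AE x in N. (\<integral>k. (u x * (of_real (G (x + of_int k)) * (\<integral>\<eta>. L \<eta> * e (\<eta> * (x + of_int k)) \<partial>lborel)))
          * indicator (A \<inter> B) (x + of_int k) \<partial>CZ) = 0"
      proof eventually_elim
        case (elim x)
        then have "u x * c * indicator (A \<inter> B) (x + of_int k) = 0" for k :: int and c
          by (auto simp: indicator_def)
        then show ?case by (intro integral_eq_zero_AE AE_I2)
      qed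
    qed
    finally show "set_lebesgue_integral M B (\<lambda>x. (v x * of_real (G x)) * indicator A x) = 0" .
  qed
  then show ?thesis by eventually_elim (auto simp: indicator_def split: if_splits)
qed

text \<open>Countable additivity only yields a series along an enumeration, while
  \<open>discrete_measure\<close> asks for an unordered sum. Absolute convergence, bounded by the
  integral of |v|, closes the gap.\<close>

lemma countable_has_sum_singletons:
  fixes v :: "'a \<Rightarrow> complex"
  assumes \<mu>: "complex_measure M \<mu>" and v: "integrable N v" and N: "sets N = sets M"
    and \<mu>_eq: "\<And>A. A \<in> sets M \<Longrightarrow> \<mu> A = (\<integral>x. indicator A x *\<^sub>R v x \<partial>N)"
    and C: "countable C" "\<And>x. x \<in> C \<Longrightarrow> {x} \<in> sets M"
  shows "((\<lambda>x. \<mu> {x}) has_sum \<mu> C) C"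
proof -
  \<comment> \<open>\<open>A n\<close> is the singleton of the point numbered n, or empty if no
    point of C has that number; finite and infinite C are thus treated alike.\<close>
  define A where "A n = {x \<in> C. to_nat_on C x = n}" for n
  have inj: "inj_on (to_nat_on C) C" using C(1) by (rule inj_on_to_nat_on)
  have A: "A n \<in> sets M" for n
  proof -
    have "countable (A n)" "A n \<subseteq> C" using C by (auto simp: A_def intro: countable_subset)
    then have "(\<Union>x\<in>A n. {x}) \<in> sets M" using C by (intro sets.countable_UN') auto
    then show ?thesis by simp
  qed
  have disj: "disjoint_family A" by (auto simp: disjoint_family_on_def A_def)
  have UN: "(\<Union>n. A n) = C" by (auto simp: A_def)
  have sums: "(\<lambda>n. \<mu> (A n)) sums \<mu> C"
    using \<mu> A disj UN unfolding complex_measure_def by (metis image_subsetI)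
  have vi: "integrable N (\<lambda>x. indicator B x *\<^sub>R cmod (v x))" if "B \<in> sets M" for B
    using v that N by (intro integrable_mult_indicator integrable_norm) auto
  have le: "cmod (\<mu> (A n)) \<le> (\<integral>x. indicator (A n) x *\<^sub>R cmod (v x) \<partial>N)" for n
    unfolding \<mu>_eq[OF A] by (rule order_trans[OF integral_norm_bound]) simp
  have "summable (\<lambda>n. cmod (\<mu> (A n)))"
  proof (rule bounded_imp_summable)
    show "(\<Sum>k\<le>n. cmod (\<mu> (A k))) \<le> (\<integral>x. cmod (v x) \<partial>N)" for n
    proof -
      have "(\<Sum>k\<le>n. cmod (\<mu> (A k))) \<le> (\<Sum>k\<le>n. \<integral>x. indicator (A k) x *\<^sub>R cmod (v x) \<partial>N)"
        by (intro sum_mono le)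
      also have "\<dots> = (\<integral>x. (\<Sum>k\<le>n. indicator (A k) x *\<^sub>R cmod (v x)) \<partial>N)"
        using vi A by (intro Bochner_Integration.integral_sum[symmetric]) auto
      also have "\<dots> \<le> (\<integral>x. cmod (v x) \<partial>N)"
      proof (rule integral_mono)
        show "integrable N (\<lambda>x. \<Sum>k\<le>n. indicator (A k) x *\<^sub>R cmod (v x))"
          using vi A by (intro Bochner_Integration.integrable_sum) auto
        show "integrable N (\<lambda>x. cmod (v x))" using v by simp
        show "(\<Sum>k\<le>n. indicator (A k) x *\<^sub>R cmod (v x)) \<le> cmod (v x)" for x
        proof -
          have "(\<Sum>k\<le>n. indicator (A k) x *\<^sub>R cmod (v x)) \<le> (\<Sum>k\<le>n. if k = to_nat_on C x then cmod (v x) else 0)"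
            by (intro sum_mono) (auto simp: A_def indicator_def)
          also have "\<dots> \<le> cmod (v x)" by (simp add: sum.delta)
          finally show ?thesis .
        qed
      qed
      finally show ?thesis .
    qed
  qed simp
  from norm_summable_imp_has_sum[OF this sums]
  have "((\<lambda>n. \<mu> (A n)) has_sum \<mu> C) UNIV" .
  moreover have "\<mu> {} = 0" using \<mu>_eq[of "{}"] by simp
  then have "\<mu> (A n) = 0" if "n \<notin> to_nat_on C ` C" for n
  proof -
    have "A n = {}" using that by (auto simp: A_def)
    then show ?thesis using \<open>\<mu> {} = 0\<close> by simp
  qed
  ultimately have "((\<lambda>n. \<mu> (A n)) has_sum \<mu> C) (to_nat_on C ` C)"
    by (subst has_sum_cong_neutral[where S=UNIV and g="\<lambda>n. \<mu> (A n)", symmetric]) auto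
  then have "((\<lambda>x. \<mu> (A (to_nat_on C x))) has_sum \<mu> C) C"
    by (simp add: has_sum_reindex[OF inj] comp_def)
  moreover have "A (to_nat_on C x) = {x}" if "x \<in> C" for x
    using that inj by (auto simp: A_def dest: inj_onD)
  ultimately show ?thesis
    by (simp cong: has_sum_cong)
qed

lemma bounded_cis: "bounded (range (\<lambda>x. cis (f x)))"
  by (auto simp: bounded_iff intro!: exI[of _ 1])

theorem theorem3p1:
  fixes \<Lambda> :: "real \<Rightarrow> complex" and \<nu> \<mu> :: "real set \<Rightarrow> complex"
  assumes "\<Lambda> \<in> F0"
    and "\<nu> \<in> M_T"
    and "\<mu> \<in> M_R"
    and "AE \<xi> in lebesgue. fourier_M_R \<mu> \<xi> = W (fourier_M_T \<nu>) \<Lambda> \<xi>"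
  shows "(ac_measure borel_circle \<nu> \<longrightarrow> ac_measure borel \<mu>) \<and>
         (discrete_measure borel_circle \<nu> \<longrightarrow>
            (\<forall>A \<in> sets borel. \<mu> A = 0) \<or> discrete_measure borel \<mu>)"
proof -
  have \<mu>: "complex_measure borel \<mu>" and \<nu>: "complex_measure borel_circle \<nu>"
    using assms(2,3) by (auto simp: M_R_def M_T_def)
  obtain L where L: "integrable lborel L"
    "AE \<xi> in lborel. \<forall>n::int. L (\<xi> - of_int n) = \<Lambda> (\<xi> - of_int n)"
    "AE \<xi> in lborel. integrable CZ (\<lambda>n. L (\<xi> - of_int n))"
    using F0_borel_version[OF assms(1)] .
  obtain M v where M: "finite_measure M" "sets M = sets borel" and v: "integrable M v"
    and \<mu>_eq: "\<And>A. A \<in> sets borel \<Longrightarrow> \<mu> A = (\<integral>x. indicator A x *\<^sub>R v x \<partial>M)"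
    and cm\<mu>: "\<And>f. f \<in> borel_measurable borel \<Longrightarrow> bounded (range f) \<Longrightarrow>
       cm_integral borel \<mu> f = (\<integral>x. f x * v x \<partial>M)"
    by (rule complex_measure_density[OF \<mu>]) (rule that)
  obtain N u where N: "finite_measure N" "sets N = sets borel_circle" and u: "integrable N u"
    and \<nu>_eq: "\<And>A. A \<in> sets borel_circle \<Longrightarrow> \<nu> A = (\<integral>x. indicator A x *\<^sub>R u x \<partial>N)"
    and cm\<nu>: "\<And>f. f \<in> borel_measurable borel_circle \<Longrightarrow> bounded (range f) \<Longrightarrow>
       cm_integral borel_circle \<nu> f = (\<integral>x. f x * u x \<partial>N)"
    by (rule complex_measure_density[OF \<nu>]) (rule that)
  have F\<mu>: "fourier_M_R \<mu> \<xi> = (\<integral>x. e (- \<xi> * x) * v x \<partial>M)" for \<xi>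
    unfolding fourier_M_R_def by (subst cm\<mu>) (simp_all add: mult.assoc bounded_cis)
  have F\<nu>: "fourier_M_T \<nu> n = (\<integral>x. e (- of_int n * x) * u x \<partial>N)" for n
    unfolding fourier_M_T_def
    by (subst cm\<nu>) (simp_all add: mult.assoc measurable_restrict_space1 bounded_cis)
  have \<phi>B: "cmod (fourier_M_T \<nu> n) \<le> (\<integral>x. cmod (u x) \<partial>N)" for n
    unfolding F\<nu> by (rule order_trans[OF integral_norm_bound]) (simp add: norm_mult)
  have "AE \<xi> in lborel. fourier_M_R \<mu> \<xi> = W (fourier_M_T \<nu>) \<Lambda> \<xi>"
    using assms(4) by (simp only: AE_completion_iff)
  with L(2,3) have AE: "AE \<xi> in lborel. (\<integral>x. e (- \<xi> * x) * v x \<partial>M)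
       = (\<integral>n. (\<integral>x. e (- of_int n * x) * u x \<partial>N) * L (\<xi> - of_int n) \<partial>CZ)"
  proof eventually_elim
    case (elim \<xi>)
    have \<Lambda>: "(\<lambda>n. fourier_M_T \<nu> n * \<Lambda> (\<xi> - of_int n)) = (\<lambda>n. fourier_M_T \<nu> n * L (\<xi> - of_int n))"
      using elim(1) by simp
    have "integrable CZ (\<lambda>n. L (\<xi> - of_int n) * fourier_M_T \<nu> n)"
      by (rule integrable_mult_bounded[OF elim(2) _ \<phi>B]) simp
    then have "integrable CZ (\<lambda>n. fourier_M_T \<nu> n * \<Lambda> (\<xi> - of_int n))"
      unfolding \<Lambda> by (simp add: mult.commute)
    from W_eq_integral[OF this]
    have "W (fourier_M_T \<nu>) \<Lambda> \<xi> = (\<integral>n. fourier_M_T \<nu> n * L (\<xi> - of_int n) \<partial>CZ)"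
      unfolding \<Lambda> .
    with elim(3) show ?case
      unfolding F\<mu> F\<nu> by simp
  qed
  note vanish = density_vanishes_on[OF L(1) N u M v AE]
  have null: "\<mu> A = 0" if "AE x in M. x \<in> A \<longrightarrow> v x = 0" "A \<in> sets borel" for A
    unfolding \<mu>_eq[OF that(2)]
    using that(1) by (intro integral_eq_zero_AE) (auto elim!: eventually_mono simp: indicator_def)
  \<comment> \<open>Cancellation could make \<nu> vanish on A alone; vanishing on all measurable
    subsets of A is what forces the density to be 0 there.\<close>
  have u_zero: "AE x in N. x \<in> A \<longrightarrow> u x = 0"
    if A: "A \<in> sets borel_circle" and \<nu>0: "\<And>B. B \<in> sets borel_circle \<Longrightarrow> B \<subseteq> A \<Longrightarrow> \<nu> B = 0" for A
  proof -
    interpret N: finite_measure N by fact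
    have "AE x in N. indicator A x *\<^sub>R u x = 0"
    proof (rule N.density_zero)
      show "integrable N (\<lambda>x. indicator A x *\<^sub>R u x)"
        using u A N by (intro integrable_mult_indicator) auto
      fix B assume B: "B \<in> sets N"
      have "set_lebesgue_integral N B (\<lambda>x. indicator A x *\<^sub>R u x) = (\<integral>x. indicator (B \<inter> A) x *\<^sub>R u x \<partial>N)"
        unfolding set_lebesgue_integral_def
        by (intro Bochner_Integration.integral_cong refl) (auto simp: indicator_def)
      also have "\<dots> = \<nu> (B \<inter> A)" using A B N by (intro \<nu>_eq[symmetric]) auto
      also have "\<dots> = 0" using A B N by (intro \<nu>0) auto
      finally show "set_lebesgue_integral N B (\<lambda>x. indicator A x *\<^sub>R u x) = 0" .
    qed
    then show ?thesis by eventually_elim (auto simp: indicator_def split: if_splits)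
  qed
  have circle: "{0..<1} \<inter> B \<in> sets borel_circle" if "B \<in> sets borel" for B :: "real set"
    using that by (subst sets_restrict_space_iff) auto
  have spN: "space N = {0..<1}"
    using sets_eq_imp_space_eq[OF N(2)] by (simp add: space_restrict_space)
  have "ac_measure borel \<mu>" if ac: "ac_measure borel_circle \<nu>"
    unfolding ac_measure_def
  proof (intro ballI impI)
    fix A :: "real set" assume A: "A \<in> sets borel" and A0: "emeasure lebesgue A = 0"
    \<comment> \<open>A - k is again Lebesgue null, and so is each Borel subset of its part in
      [0,1); absolute continuity of \<nu> then meets the hypothesis of
      \<open>u_zero\<close>.\<close>
    have "AE x in N. x + of_int k \<in> A \<longrightarrow> u x = 0" for k :: int
    proof -
      let ?B = "(\<lambda>x. x + of_int k) -` A"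
      have B: "?B \<in> sets borel"
        using measurable_sets[of "\<lambda>x. x + real_of_int k" borel borel A] A by simp
      have "emeasure lborel A = (\<integral>\<^sup>+x. indicator A (of_int k + 1 * x) \<partial>lborel)"
        using A nn_integral_real_affine[of "indicator A" 1 "of_int k"] by simp
      also have "\<dots> = (\<integral>\<^sup>+x. indicator ?B x \<partial>lborel)"
        by (intro nn_integral_cong) (simp add: indicator_def add.commute)
      finally have "emeasure lborel A = emeasure lborel ?B" using B by simp
      then have B0: "emeasure lborel ?B = 0" using A0 A by simp
      have "AE x in N. x \<in> {0..<1} \<inter> ?B \<longrightarrow> u x = 0"
      proof (rule u_zero[OF circle[OF B]])
        fix C assume C: "C \<in> sets borel_circle" "C \<subseteq> {0..<1} \<inter> ?B"
        then have "C \<in> sets borel" by (subst (asm) sets_restrict_space_iff) auto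
        then have "emeasure lebesgue C = 0"
          using B0 B C(2) emeasure_mono[of C ?B lborel] by (simp add: emeasure_completion)
        then show "\<nu> C = 0" using ac C(1) by (simp add: ac_measure_def)
      qed
      then show ?thesis using AE_space by eventually_elim (simp add: spN)
    qed
    from null[OF vanish[OF A this] A] show "\<mu> A = 0" .
  qed
  \<comment> \<open>The case \<mu> = 0 is included here, since \<open>discrete_measure\<close>
    admits weights equal to 0.\<close>
  moreover have "discrete_measure borel \<mu>" if disc: "discrete_measure borel_circle \<nu>"
  proof -
    obtain S c where S: "countable S" "\<And>A. A \<in> sets borel_circle \<Longrightarrow> (c has_sum \<nu> A) (A \<inter> S)"
      using disc unfolding discrete_measure_def by blast
    \<comment> \<open>S + Z is the set carrying the periodic extension of \<nu>, hence the only
      place where \<mu> can have mass; the weights are then forced to be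
      \<open>\<mu> {x}\<close>.\<close>
    define T where "T = (\<Union>k::int. (\<lambda>x. x + of_int k) ` S)"
    have T: "countable T" unfolding T_def using S(1) by auto
    have bS: "S \<in> sets borel" "T \<in> sets borel"
      using S(1) T by (auto intro: sets.countable)
    have "AE x in N. x \<in> {0..<1} \<inter> - S \<longrightarrow> u x = 0"
    proof (rule u_zero)
      show "{0..<1} \<inter> - S \<in> sets borel_circle" using bS by (intro circle) auto
      fix B assume B: "B \<in> sets borel_circle" "B \<subseteq> {0..<1} \<inter> - S"
      then have "B \<inter> S = {}" by auto
      with S(2)[OF B(1)] have "(c has_sum \<nu> B) {}" by simp
      then show "\<nu> B = 0" using has_sum_empty[of c] by (rule has_sum_unique)
    qed
    then have "AE x in N. x + of_int k \<in> - T \<longrightarrow> u x = 0" for k :: int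
      using AE_space by eventually_elim (auto simp: spN T_def)
    moreover have "- T \<in> sets borel" using bS by auto
    ultimately have vT: "AE x in M. x \<in> - T \<longrightarrow> v x = 0" by (intro vanish) auto
    have "((\<lambda>x. \<mu> {x}) has_sum \<mu> A) (A \<inter> T)" if A: "A \<in> sets borel" for A
    proof -
      have "\<mu> A = \<mu> (A \<inter> T)"
        unfolding \<mu>_eq[OF A] \<mu>_eq[OF sets.Int[OF A bS(2)]]
      proof (rule integral_cong_AE)
        show "AE x in M. indicator A x *\<^sub>R v x = indicator (A \<inter> T) x *\<^sub>R v x"
          using vT by eventually_elim (auto simp: indicator_def)
      qed (use v A bS M in \<open>auto intro!: borel_measurable_scaleR borel_measurable_indicator\<close>)
      moreover have "((\<lambda>x. \<mu> {x}) has_sum \<mu> (A \<inter> T)) (A \<inter> T)"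
        using T by (intro countable_has_sum_singletons[OF \<mu> v M(2) \<mu>_eq]) auto
      ultimately show ?thesis by simp
    qed
    then show ?thesis unfolding discrete_measure_def using T by auto
  qed
  ultimately show ?thesis by blast
qed

end
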